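(* Consider the extended quintic GLSM in the positive phase: $V=\operatorname{Spec}\mathbb{C}[x_1,\dots,x_5,p,u,v]\cong\mathbb{C}^8$ with gauge group $G=\mathbb{C}^*\times\mu_2$ and superpotential $W_0=p\sum_{i=1}^5x_i^5$. Let $\mathfrak{B}=\mathcal{L}\otimes\mathfrak{B}_0$ be the matrix factorization of $W_0$ obtained by twisting the Koszul matrix factorization $\mathfrak{B}_0=\{a,b\}$, with $a=(px_1^4,\dots,px_5^4)$ and $b=(x_1,\dots,x_5)$, by the line bundle $\mathcal{L}=\mathcal{O}(\mathcal{D}_1)^{\otimes 2}$, where $\mathcal{D}_1=\{x_1=0\}$ (all specified in the context). Let $Z_{D^2}(\mathfrak{B})$ be its hemisphere partition function, a function of $\theta=\zeta+2\pi\sqrt{-1}B$, and let $$\mathcal{T}^{\mathrm{CY}}(q)=2\sum_{\substack{d\in\mathbb{Z}_{>0}\\ d\ \mathrm{odd}}}\frac{(5d)!!}{(d!!)^5}\,q^{d/2}$$ be the B-model disk potential of the quintic threefold relative to its real locus. Then $$Z_{D^2}(\mathfrak{B})=64\pi^3\,\mathcal{T}^{\mathrm{CY}}(q)\Big|_{q=e^{-\theta}}.$$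
   Context: **Extended quintic GLSM.** $V=\operatorname{Spec}\mathbb{C}[x_1,\dots,x_5,p,u,v]\cong\mathbb{C}^8$ and $G=\mathbb{C}^*\times\mu_2$ with $\mu_2=\{\pm1\}$. The factor $\mathbb{C}^*$ acts with weights $(1,1,1,1,1,-5,1,-1)$ on $(x_1,\dots,x_5,p,u,v)$. The element $-1\in\mu_2$ fixes $x_1,\dots,x_5,p$ and negates $u,v$. There is also a commuting action of $\mathbb{C}^*_R$ with weights $(0,0,0,0,0,2,1,1)$. The superpotential $W_0=p\sum_{i=1}^5x_i^5$ is $G$-invariant and has $\mathbb{C}^*_R$-weight $2$. The weights $D_i$ of the Lie algebra $\mathfrak{g}=\mathbb{C}$ of $G$ are given by $\langle D_i,\sigma\rangle=\sigma$ for $x_1,\dots,x_5,u$, $\langle D_i,\sigma\rangle=-5\sigma$ for $p$, and $\langle D_i,\sigma\rangle=-\sigma$ for $v$, where $\sigma\in\mathfrak{g}=\mathbb{C}$. The $R$-charges $R_i$ satisfy $R_i/2=0$ for $x_1,\dots,x_5$, $R_i/2=1$ for $p$, and $R_i/2=1/2$ for $u,v$. In the positive phase (positive stability parameter) the GIT quotient stack is $\mathcal{X}=[\operatorname{tot}(\mathcal{O}_{\mathbb{P}^5}(-5)\oplus\mathcal{O}_{\mathbb{P}^5}(-1))/\mu_2]$, where $\mathbb{P}^5$ has homogeneous coordinates $x_1,\dots,x_5,u$ and the fiber coordinates are $p,v$. **Matrix factorizations.** A matrix factorization of $W_0$ consists of $G$-equivariant vector bundles $E_0,E_1$ of finite rank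 and $G$-equivariant maps $\delta_0:E_0\to E_1$, $\delta_1:E_1\to E_0$ with $\delta_1\delta_0=W_0\cdot\mathrm{id}$ and $\delta_0\delta_1=W_0\cdot\mathrm{id}$. Set $\mathfrak{forget}[E]:=[E_0]-[E_1]$ in $G$-equivariant K-theory. **The brane.** For $n\in\mathbb{Z}$ let $\mathcal{L}_n$ be the $G$-equivariant line bundle on $V$ associated to the character $(s,\pm1)\mapsto s^n$; $\mathcal{L}_1$ restricts on $\mathcal{X}$ to $\mathcal{O}_{\mathcal{X}}(\mathcal{D}_i)$, where $\mathcal{D}_i=\{x_i=0\}$, $1\le i\le5$. Let $U=\mathcal{L}_1^{\oplus5}$ (restricting to $\bigoplus_{i=1}^5\mathcal{O}_{\mathcal{X}}(\mathcal{D}_i)$), $b=(x_1,\dots,x_5)$ the corresponding section of $U$, and $a=(px_1^4,\dots,px_5^4)$ the corresponding section of $U^\vee$, so $\langle a,b\rangle=W_0$. Let $\mathfrak{B}_0=\{a,b\}$ be the Koszul matrix factorization with $E_0=\bigoplus_i\Lambda^{2i}U^\vee$, $E_1=\bigoplus_i\Lambda^{2i+1}U^\vee$ and both maps given by $i_b+a\wedge$ (contraction with $b$ plus exterior multiplication by $a$). Put $\mathcal{L}=\mathcal{L}_2$ and $\mathfrak{B}=\mathcal{L}\otimes\mathfrak{B}_0$. **Modified Chern character.** $\mathrm{Ch}$ is the additive map to analytic functions of $\sigma\in\mathbb{C}$ with $\mathrm{Ch}(\mathcal{L}_n)=e^{2\pi\sqrt{-1}\,n\sigma}$. Thus $\mathrm{Ch}(\mathfrak{forget}[\mathfrak{B}])=e^{4\pi\sqrt{-1}\sigma}(1-e^{-2\pi\sqrt{-1}\sigma})^5$.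 **Hemisphere partition function.** For $\theta=\zeta+2\pi\sqrt{-1}B$, $$Z_{D^2}(\mathfrak{B})=\frac{1}{2\pi\sqrt{-1}}\oint_{\delta+\sqrt{-1}\mathbb{R}}d\sigma\;\prod_{i=1}^8\Gamma\Big(\langle D_i,\sigma\rangle+\frac{R_i}{2}\Big)\,e^{\theta\sigma}\,\mathrm{Ch}(\mathfrak{forget}[\mathfrak{B}]),$$ where $\delta\in\mathbb{R}$ satisfies $\langle D_i,\delta\rangle+R_i/2>0$ for all $i$, i.e. $0<\delta<1/5$; the source does not specify an orientation of the line. Explicitly, the product of Gamma functions is $\Gamma(\sigma)^5\,\Gamma(1-5\sigma)\,\Gamma(\sigma+\tfrac12)\,\Gamma(-\sigma+\tfrac12)$. **Double factorial.** For odd $n>0$, $n!!=n(n-2)\cdots3\cdot1$. *)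

theory Defs
  imports "HOL-Analysis.Analysis" "HOL-Library.Poly_Mapping" "HOL-Library.Z2"
begin

section \<open>The extended quintic GLSM\<close>

datatype coord = Cx 5 | Cp | Cu | Cv

lemma UNIV_coord: "(UNIV :: coord set) = range Cx \<union> {Cp, Cu, Cv}"
  using coord.exhaust by auto

instance coord :: finite
  by standard (simp add: UNIV_coord)

type_synonym point = "coord \<Rightarrow> complex"

definition gauge_group :: "(complex \<times> complex) set" where
  "gauge_group = {(s, \<epsilon>). s \<noteq> 0 \<and> \<epsilon> \<in> {1, -1}}"

text \<open>
  The character group of \<open>G = \<complex>\<^sup>* \<times> \<mu>\<^sub>2\<close>, written additively: the pair \<open>(n, e)\<close> is the
  character sending \<open>(s, \<epsilon>)\<close> to \<open>s\<^sup>n \<epsilon>\<^sup>e\<close>.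
\<close>
type_synonym character = "int \<times> bit"

definition char_eval :: "character \<Rightarrow> complex \<times> complex \<Rightarrow> complex" where
  "char_eval \<eta> g = fst g powi fst \<eta> * (if snd \<eta> = 1 then snd g else 1)"

fun coord_char :: "coord \<Rightarrow> character" where
  "coord_char (Cx i) = (1, 0)"
| "coord_char Cp = (-5, 0)"
| "coord_char Cu = (1, 1)"
| "coord_char Cv = (-1, 1)"

definition act :: "complex \<times> complex \<Rightarrow> point \<Rightarrow> point" where
  "act g z = (\<lambda>i. char_eval (coord_char i) g * z i)"

fun R_charge :: "coord \<Rightarrow> int" where
  "R_charge (Cx i) = 0"
| "R_charge Cp = 2"
| "R_charge Cu = 1"
| "R_charge Cv = 1"

definition R_act :: "complex \<Rightarrow> point \<Rightarrow> point" where
  "R_act \<rho> z = (\<lambda>i. \<rho> powi R_charge i * z i)"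

text \<open>
  \<open>weight i\<close> is the derivative at the identity of the character by which \<open>G\<close> acts on the \<open>i\<close>-th
  coordinate; the factor \<open>\<mu>\<^sub>2\<close> does not contribute.
\<close>
definition weight :: "coord \<Rightarrow> complex \<Rightarrow> complex" where
  "weight i \<sigma> = of_int (fst (coord_char i)) * \<sigma>"

definition W0 :: "point \<Rightarrow> complex" where
  "W0 z = z Cp * (\<Sum>i\<in>UNIV. z (Cx i) ^ 5)"

lemma W0_invariant:
  assumes "g \<in> gauge_group"
  shows "W0 (act g z) = W0 z"
proof -
  obtain s \<epsilon> where g: "g = (s, \<epsilon>)" and s: "s \<noteq> 0"
    using assms by (auto simp: gauge_group_def)
  have "s powi (-5) * s ^ 5 = 1"
    using s by (simp add: power_int_minus)
  then have "s powi (-5) * z Cp * (s * y) ^ 5 = z Cp * y ^ 5" for y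
    by (metis (no_types, opaque_lifting) mult.assoc mult.commute mult_1 power_mult_distrib)
  then show ?thesis
    unfolding W0_def sum_distrib_left
    by (auto simp only: g act_def char_eval_def coord_char.simps fst_conv snd_conv
        power_int_1_right zero_neq_one if_False mult_1_right intro!: sum.cong)
qed

lemma W0_R_weight: "W0 (R_act \<rho> z) = \<rho>\<^sup>2 * W0 z"
  by (simp add: W0_def R_act_def)

section \<open>Matrix factorizations\<close>

text \<open>Polynomial functions on \<open>V\<close>.\<close>
inductive_set regular :: "(point \<Rightarrow> complex) set" where
  reg_const: "(\<lambda>_. c) \<in> regular"
| reg_coord: "(\<lambda>z. z i) \<in> regular"
| reg_add: "f \<in> regular \<Longrightarrow> g \<in> regular \<Longrightarrow> (\<lambda>z. f z + g z) \<in> regular"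
| reg_mult: "f \<in> regular \<Longrightarrow> g \<in> regular \<Longrightarrow> (\<lambda>z. f z * g z) \<in> regular"

text \<open>
  Since \<open>V\<close> is a representation of the diagonalizable group \<open>G\<close>, every \<open>G\<close>-equivariant vector
  bundle of finite rank on \<open>V\<close> is a direct sum of the equivariant line bundles attached to
  characters. A bundle is therefore given by a finite homogeneous basis together with the
  characters of the basis elements.
\<close>
record 'e eq_bundle =
  basis :: "'e set"
  chr :: "'e \<Rightarrow> character"

text \<open>
  A bundle map is a matrix of functions: \<open>m f e\<close> is the coefficient at \<open>f\<close> of the image of
  \<open>e\<close>. Here \<open>G\<close> acts on the total space of the line bundle of \<open>\<eta>\<close> by
  \<open>g (z, w) = (g z, \<eta>(g) w)\<close>, so that \<open>x\<^sub>i\<close> is an invariant section of the line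
  bundle \<open>line_bundle 1\<close> below.
\<close>
definition equivariant_map ::
    "'e eq_bundle \<Rightarrow> 'e eq_bundle \<Rightarrow> ('e \<Rightarrow> 'e \<Rightarrow> point \<Rightarrow> complex) \<Rightarrow> bool" where
  "equivariant_map E F m \<longleftrightarrow>
     (\<forall>e\<in>basis E. \<forall>f\<in>basis F. m f e \<in> regular \<and>
        (\<forall>g\<in>gauge_group. \<forall>z.
           m f e (act g z) * char_eval (chr E e) g = char_eval (chr F f) g * m f e z))"

record 'e factorization =
  E0 :: "'e eq_bundle"
  E1 :: "'e eq_bundle"
  d0 :: "'e \<Rightarrow> 'e \<Rightarrow> point \<Rightarrow> complex"
  d1 :: "'e \<Rightarrow> 'e \<Rightarrow> point \<Rightarrow> complex"

definition matrix_factorization :: "(point \<Rightarrow> complex) \<Rightarrow> 'e factorization \<Rightarrow> bool" where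
  "matrix_factorization W M \<longleftrightarrow>
     finite (basis (E0 M)) \<and> finite (basis (E1 M)) \<and>
     equivariant_map (E0 M) (E1 M) (d0 M) \<and> equivariant_map (E1 M) (E0 M) (d1 M) \<and>
     (\<forall>e\<in>basis (E0 M). \<forall>e'\<in>basis (E0 M). \<forall>z.
        (\<Sum>f\<in>basis (E1 M). d1 M e' f z * d0 M f e z) = (if e' = e then W z else 0)) \<and>
     (\<forall>f\<in>basis (E1 M). \<forall>f'\<in>basis (E1 M). \<forall>z.
        (\<Sum>e\<in>basis (E0 M). d0 M f' e z * d1 M e f z) = (if f' = f then W z else 0))"

definition twist_bundle :: "character \<Rightarrow> 'e eq_bundle \<Rightarrow> 'e eq_bundle" where
  "twist_bundle \<eta> E = E\<lparr>chr := \<lambda>e. \<eta> + chr E e\<rparr>"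

definition twist :: "character \<Rightarrow> 'e factorization \<Rightarrow> 'e factorization" where
  "twist \<eta> M = M\<lparr>E0 := twist_bundle \<eta> (E0 M), E1 := twist_bundle \<eta> (E1 M)\<rparr>"

text \<open>
  \<open>koszul c a b\<close> is the Koszul factorization \<open>{a, b}\<close> of the bundle \<open>U\<close> that is the sum of the
  line bundles with characters \<open>c i\<close>. The basis element \<open>S = {i\<^sub>1 < \<dots> < i\<^sub>k}\<close> stands for
  \<open>e\<^sub>i\<^sub>1 \<and> \<dots> \<and> e\<^sub>i\<^sub>k\<close>, where the \<open>e\<^sub>i\<close> are the basis of \<open>U\<^sup>\<or>\<close> dual to
  the given decomposition, and
  \<open>koszul_sign S i\<close> is the sign arising when \<open>e\<^sub>i\<close> is moved to or from the first position.
\<close>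
definition koszul_sign :: "'i::linorder set \<Rightarrow> 'i \<Rightarrow> complex" where
  "koszul_sign S i = (-1) ^ card {j\<in>S. j < i}"

definition contraction ::
    "('i::{finite,linorder} \<Rightarrow> point \<Rightarrow> complex) \<Rightarrow> 'i set \<Rightarrow> 'i set \<Rightarrow> point \<Rightarrow> complex" where
  "contraction b T S z = (\<Sum>i\<in>S. if T = S - {i} then koszul_sign S i * b i z else 0)"

definition wedge ::
    "('i::{finite,linorder} \<Rightarrow> point \<Rightarrow> complex) \<Rightarrow> 'i set \<Rightarrow> 'i set \<Rightarrow> point \<Rightarrow> complex" where
  "wedge a T S z = (\<Sum>i\<in>-S. if T = insert i S then koszul_sign S i * a i z else 0)"

definition koszul_map ::
    "('i::{finite,linorder} \<Rightarrow> point \<Rightarrow> complex) \<Rightarrow> ('i \<Rightarrow> point \<Rightarrow> complex) \<Rightarrow>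
     'i set \<Rightarrow> 'i set \<Rightarrow> point \<Rightarrow> complex" where
  "koszul_map a b T S z = contraction b T S z + wedge a T S z"

definition koszul ::
    "('i::{finite,linorder} \<Rightarrow> character) \<Rightarrow> ('i \<Rightarrow> point \<Rightarrow> complex) \<Rightarrow>
     ('i \<Rightarrow> point \<Rightarrow> complex) \<Rightarrow> 'i set factorization" where
  "koszul c a b =
     \<lparr>E0 = \<lparr>basis = {S. even (card S)}, chr = \<lambda>S. - (\<Sum>i\<in>S. c i)\<rparr>,
      E1 = \<lparr>basis = {S. odd (card S)}, chr = \<lambda>S. - (\<Sum>i\<in>S. c i)\<rparr>,
      d0 = koszul_map a b,
      d1 = koszul_map a b\<rparr>"

lemma koszul_sign_square [simp]: "koszul_sign S i * koszul_sign S i = 1"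
  by (simp add: koszul_sign_def flip: power_add mult_2)

definition flip :: "'i \<Rightarrow> 'i set \<Rightarrow> 'i set" where
  "flip i S = (if i \<in> S then S - {i} else insert i S)"

lemma koszul_map_flip:
  "koszul_map a b T S z =
     (\<Sum>i\<in>UNIV. if T = flip i S then koszul_sign S i * (if i \<in> S then b i z else a i z) else 0)"
proof -
  have "(\<Sum>i\<in>UNIV. h i) = (\<Sum>i\<in>S. h i) + (\<Sum>i\<in>-S. h i)" for h :: "'a \<Rightarrow> complex"
    by (subst sum.union_disjoint[symmetric]) auto
  then show ?thesis
    unfolding koszul_map_def contraction_def wedge_def
    by (auto simp: flip_def intro!: arg_cong2[where f = "(+)"] sum.cong)
qed

lemma koszul_sign_flip:
  fixes S :: "'i::{finite,linorder} set"
  assumes "i \<noteq> j"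
  shows "koszul_sign (flip i S) j = (if i < j then - koszul_sign S j else koszul_sign S j)"
proof (cases "i < j")
  case False
  then have "{k \<in> flip i S. k < j} = {k \<in> S. k < j}"
    by (auto simp: flip_def)
  with False show ?thesis by (simp add: koszul_sign_def)
next
  case lt: True
  show ?thesis
  proof (cases "i \<in> S")
    case True
    have "{k \<in> S. k < j} = insert i {k \<in> flip i S. k < j}"
      using True lt by (auto simp: flip_def)
    moreover have "i \<notin> {k \<in> flip i S. k < j}"
      using True by (simp add: flip_def)
    ultimately have "card {k \<in> S. k < j} = Suc (card {k \<in> flip i S. k < j})"
      by (simp del: mem_Collect_eq)
    with lt show ?thesis by (simp add: koszul_sign_def)
  next
    case False
    have "{k \<in> flip i S. k < j} = insert i {k \<in> S. k < j}"
      using False lt by (auto simp: flip_def)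
    with False have "card {k \<in> flip i S. k < j} = Suc (card {k \<in> S. k < j})"
      by simp
    with lt show ?thesis by (simp add: koszul_sign_def)
  qed
qed

lemma koszul_map_square:
  fixes a b :: "'i::{finite,linorder} \<Rightarrow> point \<Rightarrow> complex"
  assumes "\<And>i. flip i S \<in> A"
  shows "(\<Sum>R\<in>A. koszul_map a b T R z * koszul_map a b R S z) =
         (if T = S then \<Sum>i\<in>UNIV. a i z * b i z else 0)"
proof -
  define h where "h i Q = (if i \<in> Q then b i z else a i z)" for i and Q :: "'i set"
  define F where "F i j = (if T = flip j (flip i S) then
      koszul_sign (flip i S) j * h j (flip i S) * (koszul_sign S i * h i S) else 0)" for i j
  have "(\<Sum>R\<in>A. koszul_map a b T R z * koszul_map a b R S z) =
        (\<Sum>R\<in>A. \<Sum>i\<in>UNIV. if R = flip i S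
           then koszul_map a b T R z * (koszul_sign S i * h i S) else 0)"
    by (rule sum.cong) (auto simp: koszul_map_flip[of a b _ S] h_def sum_distrib_left intro!: sum.cong)
  also have "\<dots> = (\<Sum>i\<in>UNIV. koszul_map a b T (flip i S) z * (koszul_sign S i * h i S))"
    by (subst sum.swap) (simp add: assms)
  also have "\<dots> = (\<Sum>i\<in>UNIV. \<Sum>j\<in>UNIV. F i j)"
    by (rule sum.cong)
      (auto simp: koszul_map_flip F_def h_def sum_distrib_right intro!: sum.cong)
  finally have eq: "(\<Sum>R\<in>A. koszul_map a b T R z * koszul_map a b R S z) =
      (\<Sum>i\<in>UNIV. \<Sum>j\<in>UNIV. F i j)" .
  have diag: "F i i = (if T = S then a i z * b i z else 0)" for i
  proof -
    have "flip i (flip i S) = S" "i \<in> flip i S \<longleftrightarrow> i \<notin> S"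
      by (auto simp: flip_def)
    moreover have "koszul_sign (flip i S) i = koszul_sign S i"
      unfolding koszul_sign_def flip_def
      by (rule arg_cong[where f = "\<lambda>X. (-1) ^ card X"]) auto
    moreover have "koszul_sign S i * x * (koszul_sign S i * y) = x * y" for x y
      by (metis koszul_sign_square mult.assoc mult.left_commute mult_1)
    ultimately show ?thesis
      by (auto simp: F_def h_def mult.commute)
  qed
  have anti: "F i j = - F j i" if "i \<noteq> j" for i j
  proof -
    have "flip j (flip i S) = flip i (flip j S)" "j \<in> flip i S \<longleftrightarrow> j \<in> S" "i \<in> flip j S \<longleftrightarrow> i \<in> S"
      using that by (auto simp: flip_def)
    with that show ?thesis
      by (auto simp: F_def h_def koszul_sign_flip not_less)
  qed
  define H where "H i j = (if i = j then 0 else F i j)" for i j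
  have "(\<Sum>i\<in>UNIV. \<Sum>j\<in>UNIV. H i j) = (\<Sum>i\<in>UNIV. \<Sum>j\<in>UNIV. - H i j)"
    by (subst sum.swap) (auto simp: H_def intro!: sum.cong anti)
  then have "(\<Sum>i\<in>UNIV. \<Sum>j\<in>UNIV. H i j) = 0"
    by (simp add: sum_negf)
  moreover have "(\<Sum>i\<in>UNIV. \<Sum>j\<in>UNIV. F i j) =
      (\<Sum>i\<in>UNIV. \<Sum>j\<in>UNIV. H i j + (if i = j then F i i else 0))"
    by (intro sum.cong) (auto simp: H_def)
  ultimately have "(\<Sum>i\<in>UNIV. \<Sum>j\<in>UNIV. F i j) = (\<Sum>i\<in>UNIV. F i i)"
    by (simp add: sum.distrib)
  with eq diag show ?thesis by simp
qed

lemma even_card_flip: "even (card (flip i S)) \<longleftrightarrow> odd (card S)" for S :: "'i::finite set"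
proof (cases "i \<in> S")
  case True
  then have "card S = Suc (card (flip i S))"
    unfolding flip_def using card_Suc_Diff1[of S i] by simp
  then show ?thesis by simp
qed (simp add: flip_def)

lemma char_eval_add:
  assumes "g \<in> gauge_group"
  shows "char_eval (\<eta> + \<eta>') g = char_eval \<eta> g * char_eval \<eta>' g"
  using assms
  by (cases "snd \<eta>"; cases "snd \<eta>'")
    (auto simp: char_eval_def gauge_group_def power_int_add)

lemma regular_power: "f \<in> regular \<Longrightarrow> (\<lambda>z. f z ^ n) \<in> regular"
  by (induction n) (auto intro: regular.intros)

lemma regular_sum:
  "(\<And>i. i \<in> I \<Longrightarrow> f i \<in> regular) \<Longrightarrow> (\<lambda>z. \<Sum>i\<in>I. f i z) \<in> regular"
  by (induction I rule: infinite_finite_induct) (auto intro: regular.intros)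

lemma koszul_map_equivariant:
  fixes a b :: "'i::{finite,linorder} \<Rightarrow> point \<Rightarrow> complex"
  assumes reg: "\<And>i. a i \<in> regular" "\<And>i. b i \<in> regular"
    and b: "\<And>i g z. g \<in> gauge_group \<Longrightarrow> b i (act g z) = char_eval (c i) g * b i z"
    and a: "\<And>i g z. g \<in> gauge_group \<Longrightarrow> a i (act g z) = char_eval (- c i) g * a i z"
  shows "koszul_map a b T S \<in> regular"
    and "g \<in> gauge_group \<Longrightarrow>
      koszul_map a b T S (act g z) * char_eval (\<eta> - (\<Sum>i\<in>S. c i)) g =
      char_eval (\<eta> - (\<Sum>i\<in>T. c i)) g * koszul_map a b T S z"
proof -
  have "(\<lambda>z. if P then k * (if Q then b i z else a i z) else 0) \<in> regular" for P Q k i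
    using reg by (cases P; cases Q) (auto intro: regular.intros)
  then have "(\<lambda>z. \<Sum>i\<in>UNIV. if T = flip i S
      then koszul_sign S i * (if i \<in> S then b i z else a i z) else 0) \<in> regular"
    by (intro regular_sum) auto
  then show "koszul_map a b T S \<in> regular"
    by (simp add: koszul_map_flip[abs_def])
next
  assume g: "g \<in> gauge_group"
  have "(if i \<in> S then b i (act g z) else a i (act g z)) * char_eval (\<eta> - (\<Sum>j\<in>S. c j)) g =
        char_eval (\<eta> - (\<Sum>j\<in>flip i S. c j)) g * (if i \<in> S then b i z else a i z)" for i
  proof (cases "i \<in> S")
    case True
    have "(\<Sum>j\<in>S. c j) = c i + (\<Sum>j\<in>flip i S. c j)"
      using True by (simp add: flip_def sum.remove)
    then have "\<eta> - (\<Sum>j\<in>flip i S. c j) = c i + (\<eta> - (\<Sum>j\<in>S. c j))"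
      by (simp add: algebra_simps)
    then show ?thesis
      using True g by (simp only: b char_eval_add if_True) simp
  next
    case False
    then have "\<eta> - (\<Sum>j\<in>flip i S. c j) = - c i + (\<eta> - (\<Sum>j\<in>S. c j))"
      by (simp add: flip_def algebra_simps)
    then show ?thesis
      using False g by (simp only: a char_eval_add if_False) simp
  qed
  then show "koszul_map a b T S (act g z) * char_eval (\<eta> - (\<Sum>i\<in>S. c i)) g =
      char_eval (\<eta> - (\<Sum>i\<in>T. c i)) g * koszul_map a b T S z"
    unfolding koszul_map_flip sum_distrib_left sum_distrib_right
    by (intro sum.cong) (auto simp: mult_ac)
qed

lemma koszul_matrix_factorization:
  fixes a b :: "'i::{finite,linorder} \<Rightarrow> point \<Rightarrow> complex"
  assumes "\<And>i. a i \<in> regular" "\<And>i. b i \<in> regular"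
    and "\<And>i g z. g \<in> gauge_group \<Longrightarrow> b i (act g z) = char_eval (c i) g * b i z"
    and "\<And>i g z. g \<in> gauge_group \<Longrightarrow> a i (act g z) = char_eval (- c i) g * a i z"
  shows "matrix_factorization (\<lambda>z. \<Sum>i\<in>UNIV. a i z * b i z) (twist \<eta> (koszul c a b))"
proof -
  let ?m = "koszul_map a b" and ?K = "\<lambda>S. \<eta> - (\<Sum>i\<in>S. c i)"
  have "?m T S \<in> regular" for T S
    by (rule koszul_map_equivariant(1)[of a b c, OF assms])
  moreover have "?m T S (act g z) * char_eval (?K S) g = char_eval (?K T) g * ?m T S z"
    if "g \<in> gauge_group" for T S g z
    by (rule koszul_map_equivariant(2)[of a b c, OF assms that])
  ultimately have eqv: "equivariant_map \<lparr>basis = A, chr = ?K\<rparr> \<lparr>basis = A', chr = ?K\<rparr> ?m"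
    for A A'
    unfolding equivariant_map_def by simp
  have tw: "twist \<eta> (koszul c a b) =
      \<lparr>E0 = \<lparr>basis = {S. even (card S)}, chr = ?K\<rparr>,
       E1 = \<lparr>basis = {S. odd (card S)}, chr = ?K\<rparr>, d0 = ?m, d1 = ?m\<rparr>"
    by (simp add: twist_def twist_bundle_def koszul_def)
  show ?thesis
    unfolding matrix_factorization_def tw
    by (simp only: factorization.simps eq_bundle.simps eqv finite)
      (simp add: koszul_map_square even_card_flip)
qed

section \<open>The brane\<close>

definition line_bundle :: "int \<Rightarrow> character" where
  "line_bundle n = (n, 0)"

definition brane0 :: "5 set factorization" where
  "brane0 = koszul (\<lambda>i. line_bundle 1) (\<lambda>i z. z Cp * z (Cx i) ^ 4) (\<lambda>i z. z (Cx i))"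

definition brane :: "5 set factorization" where
  "brane = twist (line_bundle 2) brane0"

lemma brane_matrix_factorization: "matrix_factorization W0 brane"
proof -
  have W0: "W0 = (\<lambda>z. \<Sum>i\<in>UNIV. z Cp * z (Cx i) ^ 4 * z (Cx i))"
    by (auto simp: W0_def sum_distrib_left power_Suc2[symmetric] mult.assoc
        simp del: power_Suc)
  have powi: "s powi (-5) * s ^ 4 = s powi (-1)" if "s \<noteq> 0" for s :: complex
    using that by (simp add: power_int_minus field_simps eval_nat_numeral)
  have a: "s powi (-5) * w * (s * y) ^ 4 = s powi (-1) * (w * y ^ 4)"
    if "s \<noteq> 0" for s w y :: complex
    unfolding power_mult_distrib powi[OF that, symmetric] by (simp only: mult_ac)
  show ?thesis
    unfolding W0 brane_def brane0_def
  proof (rule koszul_matrix_factorization)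
    show "(\<lambda>z. z Cp * z (Cx i) ^ 4) \<in> regular" for i
      by (intro regular.intros regular_power)
    show "(\<lambda>z. z (Cx i)) \<in> regular" for i
      by (rule regular.intros)
    show "act g z (Cx i) = char_eval (line_bundle 1) g * z (Cx i)" for i g z
      by (simp add: act_def line_bundle_def)
    show "act g z Cp * act g z (Cx i) ^ 4 = char_eval (- line_bundle 1) g * (z Cp * z (Cx i) ^ 4)"
      if "g \<in> gauge_group" for i g z
    proof -
      from that obtain s \<epsilon> where g: "g = (s, \<epsilon>)" and s: "s \<noteq> 0"
        by (auto simp: gauge_group_def)
      show ?thesis
        using a[OF s, of "z Cp" "z (Cx i)"]
        by (simp only: g act_def line_bundle_def char_eval_def coord_char.simps uminus_Pair
            fst_conv snd_conv power_int_1_right neg_0_equal_iff_equal minus_zero zero_neq_one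
            if_False mult_1_right)
    qed
  qed
qed

text \<open>
  \<open>K\<^sub>G(V)\<close> is the representation ring of \<open>G\<close>, the group ring of its character group.
\<close>
definition bundle_class :: "'e eq_bundle \<Rightarrow> character \<Rightarrow>\<^sub>0 int" where
  "bundle_class E = (\<Sum>e\<in>basis E. Poly_Mapping.single (chr E e) 1)"

definition forget :: "'e factorization \<Rightarrow> character \<Rightarrow>\<^sub>0 int" where
  "forget M = bundle_class (E0 M) - bundle_class (E1 M)"

definition Ch :: "(character \<Rightarrow>\<^sub>0 int) \<Rightarrow> complex \<Rightarrow> complex" where
  "Ch \<kappa> \<sigma> = (\<Sum>\<eta>\<in>Poly_Mapping.keys \<kappa>.
      of_int (Poly_Mapping.lookup \<kappa> \<eta>) * exp (2 * of_real pi * \<i> * of_int (fst \<eta>) * \<sigma>))"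

section \<open>Hemisphere partition function and disk potential\<close>

definition admissible :: "real \<Rightarrow> bool" where
  "admissible \<delta> \<longleftrightarrow> (\<forall>i. Re (weight i (of_real \<delta>)) + of_int (R_charge i) / 2 > 0)"

definition hemisphere_integrand :: "'e factorization \<Rightarrow> complex \<Rightarrow> complex \<Rightarrow> complex" where
  "hemisphere_integrand M \<theta> \<sigma> =
     (\<Prod>i\<in>UNIV. Gamma (weight i \<sigma> + of_int (R_charge i) / 2)) * exp (\<theta> * \<sigma>) * Ch (forget M) \<sigma>"

text \<open>
  The line \<open>\<delta> + \<i>\<real>\<close> is parametrized by \<open>\<sigma> = \<delta> - \<i> t\<close>, i.e. oriented from \<open>\<delta> + \<i>\<infinity>\<close> to
  \<open>\<delta> - \<i>\<infinity>\<close>; this makes the poles in the half-plane \<open>Re \<sigma> < \<delta>\<close> contribute the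
  negatives of their residues, which sum to \<open>64 \<pi>\<^sup>3\<close> times the disk potential (with the opposite
  orientation the two sides would differ by a sign). \<open>hemisphere_line\<close> is the pulled-back form
  \<open>f(\<sigma>) d\<sigma>\<close>.
\<close>
definition hemisphere_line ::
    "'e factorization \<Rightarrow> real \<Rightarrow> complex \<Rightarrow> real \<Rightarrow> complex" where
  "hemisphere_line M \<delta> \<theta> t =
     hemisphere_integrand M \<theta> (of_real \<delta> - \<i> * of_real t) * (- \<i>)"

definition Z_D2 :: "'e factorization \<Rightarrow> real \<Rightarrow> complex \<Rightarrow> complex" where
  "Z_D2 M \<delta> \<theta> =
     1 / (2 * of_real pi * \<i>) * (LINT t|lborel. hemisphere_line M \<delta> \<theta> t)"

fun double_fact :: "nat \<Rightarrow> nat" where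
  "double_fact 0 = 1"
| "double_fact (Suc 0) = 1"
| "double_fact (Suc (Suc n)) = Suc (Suc n) * double_fact n"

text \<open>
  The half-integral powers make the potential a function of a square root \<open>r\<close> of \<open>q\<close>, with
  \<open>q\<^bsup>d/2\<^esup> = r\<^sup>d\<close>. For \<open>q = e\<^bsup>-\<theta>\<^esup>\<close> one has \<open>q\<^bsup>d/2\<^esup> = e\<^bsup>-d\<theta>/2\<^esup>\<close>, i.e. \<open>r = e\<^bsup>-\<theta>/2\<^esup>\<close>.
\<close>
definition T_CY_term :: "complex \<Rightarrow> nat \<Rightarrow> complex" where
  "T_CY_term r d = of_nat (double_fact (5 * d)) / of_nat (double_fact d) ^ 5 * r ^ d"

definition T_CY :: "complex \<Rightarrow> complex" where
  "T_CY r = 2 * (\<Sum>\<^sub>\<infinity>d\<in>{d. odd d}. T_CY_term r d)"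

end

theory Submission
  imports Defs "HOL-Complex_Analysis.Complex_Analysis" "HOL-Probability.Sinc_Integral"
begin

text \<open>
  Since \<open>Ch(brane) = 32 \<i> e\<^bsup>-\<pi>\<i>\<sigma>\<^esup> sin\<^sup>5 \<pi>\<sigma>\<close>, the reflection formula turns the integrand into
  \<open>32 \<i> \<pi>\<^sup>6 \<Gamma>(1 - 5\<sigma>) \<Gamma>(1 - \<sigma>)\<^bsup>-5\<^esup> e\<^bsup>(\<theta> - \<pi>\<i>)\<sigma>\<^esup> / cos \<pi>\<sigma>\<close>, which to the left of
  \<open>Re \<sigma> = 1/5\<close> has only the simple poles \<open>\<sigma> = -d/2\<close>, \<open>d > 0\<close> odd; the residue there is
  \<open>-128 \<pi>\<^sup>3\<close> times \<open>(5d)!! (d!!)\<^bsup>-5\<^esup> q\<^bsup>d/2\<^esup>\<close>. The exponentials cancel exactly at the boundary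
  values \<open>B \<in> {0, 1}\<close> and \<open>\<zeta> = 5 ln 5\<close>, so all convergence rests on the factor
  \<open>\<bar>\<sigma>\<bar>\<^sup>-\<^sup>2\<close> by which the quotient of Gamma functions decays relative to \<open>5\<^bsup>-5 Re \<sigma>\<^esup>\<close>. It makes
  the line integral converge, lets the line be moved to \<open>Re \<sigma> = -N\<close>, makes the remaining integral
  tend to zero, and bounds the terms of the series by a multiple of \<open>d\<^sup>-\<^sup>2\<close>.
\<close>

section \<open>Decay of the quintic Gamma quotient\<close>

lemma Re_pos_not_nonpos_Ints: "Re z > 0 \<Longrightarrow> z \<notin> \<int>\<^sub>\<le>\<^sub>0"
  by (auto elim!: nonpos_Ints_cases')

text \<open>This is the finite form of Gauss's multiplication formula: the \<open>m * n\<close>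
  factors are sorted by the residue of their index modulo \<open>m\<close>, and a factor
  \<open>m\<close> is taken out of each. The induction adds one block of \<open>m\<close>
  consecutive factors at a time.\<close>

lemma pochhammer_multiply:
  fixes z :: "'a::field_char_0"
  assumes "m > 0"
  shows "pochhammer (of_nat m * z) (m * n) =
         of_nat m ^ (m * n) * (\<Prod>k<m. pochhammer (z + of_nat k / of_nat m) n)"
proof (induction n)
  case (Suc n)
  have "pochhammer (of_nat m * z + of_nat (m * n)) m =
        (\<Prod>k<m. of_nat m * (z + of_nat k / of_nat m + of_nat n))"
    using assms by (auto simp: pochhammer_prod lessThan_atLeast0 field_simps intro!: prod.cong)
  also have "\<dots> = of_nat m ^ m * (\<Prod>k<m. z + of_nat k / of_nat m + of_nat n)"
    by (simp add: prod.distrib)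
  finally have "pochhammer (of_nat m * z + of_nat (m * n)) m =
      of_nat m ^ m * (\<Prod>k<m. z + of_nat k / of_nat m + of_nat n)" .
  then show ?case
    unfolding mult_Suc_right add.commute[of m] pochhammer_product' Suc.IH
    by (simp only: pochhammer_Suc prod.distrib power_add mult_ac)
qed simp

text \<open>
  Gauss's multiplication formula, with the value \<open>m\<^bsup>-1/2\<^esup> (2 \<pi>)\<^bsup>(1 - m)/2\<^esup>\<close> of the constant left out.
\<close>
lemma Gamma_multiplication:
  assumes "m > 0"
  obtains K :: complex where "\<And>z. of_nat m * z \<notin> \<int>\<^sub>\<le>\<^sub>0 \<Longrightarrow>
    Gamma (of_nat m * z) =
      K * exp (of_nat m * z * of_real (ln m)) * (\<Prod>k<m. Gamma (z + of_nat k / of_nat m))"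
proof -
  let ?E = "\<lambda>z x. exp (z * of_real (ln x)) :: complex"
  define P where "P z n = (\<Prod>k<m. Gamma_series' (z + of_nat k / of_nat m) n)" for z :: complex and n
  \<comment> \<open>\<open>K n\<close> gathers everything in the quotient of the approximants for
    \<open>of_nat m * z\<close> and for the \<open>z + of_nat k / of_nat m\<close> that is free of
    \<open>z\<close>.\<close>
  define K where "K n = fact (m * n - 1) /
      (fact (n - 1) ^ m * of_nat m ^ (m * n) * (\<Prod>k<m. ?E (of_nat k / of_nat m) n))" for n :: nat
  have nonpos: "z + of_nat k / of_nat m \<notin> \<int>\<^sub>\<le>\<^sub>0" if "of_nat m * z \<notin> \<int>\<^sub>\<le>\<^sub>0" for z :: complex and k
  proof
    assume "z + of_nat k / of_nat m \<in> \<int>\<^sub>\<le>\<^sub>0"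
    then obtain j where "z + of_nat k / of_nat m = - of_nat j"
      by (auto elim!: nonpos_Ints_cases')
    then have "of_nat m * z = - of_nat (m * j + k)"
      using assms by (simp add: field_simps add_eq_0_iff)
        (metis add.commute add_diff_cancel_left' diff_minus_eq_add minus_add_distrib mult.commute)
    with that show False by (metis minus_of_nat_in_nonpos_Ints)
  qed
  have eq: "Gamma_series' (of_nat m * z) (m * n) = K n * ?E (of_nat m * z) m * P z n"
    if z: "of_nat m * z \<notin> \<int>\<^sub>\<le>\<^sub>0" and n: "n > 0" for z n
  proof -
    have "pochhammer (z + of_nat k / of_nat m) n \<noteq> 0" for k
      using nonpos[OF z] by (auto dest: pochhammer_eq_0_imp_nonpos_Int)
    then have nz: "(\<Prod>k<m. pochhammer (z + of_nat k / of_nat m) n) \<noteq> 0"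
      by simp
    have "?E (of_nat m * z) (m * n) = ?E (of_nat m * z) m * ?E (of_nat m * z) n"
      using assms n by (simp add: ln_mult exp_add algebra_simps)
    moreover have "?E (of_nat m * z) n = (\<Prod>k<m. ?E z n)"
      by (simp add: exp_of_nat_mult mult.assoc)
    moreover have "P z n = fact (n - 1) ^ m * ((\<Prod>k<m. ?E z n) * (\<Prod>k<m. ?E (of_nat k / of_nat m) n)) /
        (\<Prod>k<m. pochhammer (z + of_nat k / of_nat m) n)"
      by (simp add: P_def Gamma_series'_def prod.distrib prod_dividef algebra_simps exp_add
          flip: power_mult_distrib)
    ultimately show ?thesis
      using assms n nz unfolding Gamma_series'_def pochhammer_multiply[OF assms] K_def
      by (simp add: divide_simps)
  qed
  have lim_P: "P z \<longlonglongrightarrow> (\<Prod>k<m. Gamma (z + of_nat k / of_nat m))" for z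
    unfolding P_def by (intro tendsto_prod Gamma_series'_LIMSEQ)
  have lim: "(\<lambda>n. K n * ?E (of_nat m * z) m * P z n) \<longlonglongrightarrow> Gamma (of_nat m * z)"
    if "of_nat m * z \<notin> \<int>\<^sub>\<le>\<^sub>0" for z
  proof (rule Lim_transform_eventually)
    show "(\<lambda>n. Gamma_series' (of_nat m * z) (m * n)) \<longlonglongrightarrow> Gamma (of_nat m * z)"
      using LIMSEQ_subseq_LIMSEQ[OF Gamma_series'_LIMSEQ, of "(*) m" "of_nat m * z"] assms
      by (simp add: o_def strict_mono_def)
    show "\<forall>\<^sub>F n in sequentially. Gamma_series' (of_nat m * z) (m * n) =
        K n * ?E (of_nat m * z) m * P z n"
      using eventually_gt_at_top[of 0] by eventually_elim (rule eq[OF that])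
  qed
  have nz: "?E (of_nat m * z) m * (\<Prod>k<m. Gamma (z + of_nat k / of_nat m)) \<noteq> 0"
    if "of_nat m * z \<notin> \<int>\<^sub>\<le>\<^sub>0" for z
    using nonpos[OF that] by (simp add: Gamma_eq_zero_iff)
  \<comment> \<open>All other factors have nonzero limits, so \<open>K\<close> converges. As the
    sequence does not depend on \<open>z\<close>, uniqueness of limits gives the same constant
    \<open>lim K\<close> for every \<open>z\<close>.\<close>
  have lim_K: "K \<longlonglongrightarrow> Gamma (of_nat m * z) /
      (?E (of_nat m * z) m * (\<Prod>k<m. Gamma (z + of_nat k / of_nat m)))"
    if "of_nat m * z \<notin> \<int>\<^sub>\<le>\<^sub>0" for z
  proof (rule Lim_transform_eventually)
    have lim_EP: "(\<lambda>n. ?E (of_nat m * z) m * P z n) \<longlonglongrightarrow>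
        ?E (of_nat m * z) m * (\<Prod>k<m. Gamma (z + of_nat k / of_nat m))"
      by (intro tendsto_intros lim_P)
    show "(\<lambda>n. K n * ?E (of_nat m * z) m * P z n / (?E (of_nat m * z) m * P z n)) \<longlonglongrightarrow>
        Gamma (of_nat m * z) / (?E (of_nat m * z) m * (\<Prod>k<m. Gamma (z + of_nat k / of_nat m)))"
      using nz[OF that] by (intro tendsto_divide lim[OF that] lim_EP)
    show "\<forall>\<^sub>F n in sequentially.
        K n * ?E (of_nat m * z) m * P z n / (?E (of_nat m * z) m * P z n) = K n"
      using tendsto_imp_eventually_ne[OF lim_EP nz[OF that]] by eventually_elim simp
  qed
  have one: "of_nat m * (1::complex) \<notin> \<int>\<^sub>\<le>\<^sub>0"
    using assms by (auto elim!: nonpos_Ints_cases' simp: complex_eq_iff)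
  show thesis
  proof (rule that)
    fix z :: complex assume z: "of_nat m * z \<notin> \<int>\<^sub>\<le>\<^sub>0"
    show "Gamma (of_nat m * z) = lim K * ?E (of_nat m * z) m * (\<Prod>k<m. Gamma (z + of_nat k / of_nat m))"
      using limI[OF lim_K[OF z]] nz[OF z] by (simp add: field_simps)
  qed
qed

text \<open>
  For \<open>w = z + j\<close> one has \<open>(w + s) (w + 1 - s) = w (w + 1) + s (1 - s)\<close>, so pairing \<open>s\<close> with
  \<open>1 - s\<close> leaves partial products whose factors are \<open>1 + O(j\<^sup>-\<^sup>2)\<close> uniformly in \<open>z\<close>. This
  replaces Stirling's formula.
\<close>
lemma Gamma_pair_bound:
  fixes s a :: real
  assumes "a < s" "a < 1 - s" "0 < s" "s < 1"
  obtains C where "C \<ge> 0" and "\<And>z::complex. - a \<le> Re z \<Longrightarrow>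
    norm (Gamma (z + of_real s) * Gamma (z + of_real (1 - s))) * norm z \<le> C * norm (Gamma (z + 1)) ^ 2"
proof -
  \<comment> \<open>On the half-plane \<open>- a \<le> Re z\<close>, both \<open>z + s + j\<close>
    and \<open>z + 1 - s + j\<close> have real part at least \<open>j + \<eta>\<close>. Hence
    \<open>h j\<close> bounds the relative error of the \<open>j\<close>-th pair of factors
    independently of \<open>z\<close>.\<close>
  define \<eta> where "\<eta> = min s (1 - s) - a"
  define c where "c = s * (1 - s)"
  define h where "h j = c / (real j + \<eta>) ^ 2" for j
  have \<eta>: "\<eta> > 0" and c: "c \<ge> 0"
    using assms by (auto simp: \<eta>_def c_def)
  have h_nonneg: "h j \<ge> 0" for j
    using c by (simp add: h_def)
  have "summable h"
  proof (rule summable_comparison_test_ev)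
    show "\<forall>\<^sub>F j in sequentially. norm (h j) \<le> c * inverse (real j ^ 2)"
      using eventually_gt_at_top[of 0]
    proof eventually_elim
      case (elim j)
      then have "real j ^ 2 \<le> (real j + \<eta>) ^ 2"
        using \<eta> by (intro power_mono) auto
      then show ?case
        using c elim \<eta> by (auto simp: h_def divide_inverse intro!: mult_left_mono le_imp_inverse_le)
    qed
    show "summable (\<lambda>j. c * inverse (real j ^ 2))"
      by (intro summable_mult inverse_power_summable) simp
  qed
  show thesis
  proof (rule that[of "exp (suminf h)"])
    fix z :: complex assume z: "- a \<le> Re z"
    let ?G = Gamma_series'
    show "norm (Gamma (z + of_real s) * Gamma (z + of_real (1 - s))) * norm z \<le>
        exp (suminf h) * norm (Gamma (z + 1)) ^ 2"
    proof (cases "z = 0")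
      case False
      \<comment> \<open>The hypotheses force \<open>a < 1 / 2\<close>, so \<open>0\<close> is the
        only pole of \<open>Gamma\<close> in the half-plane. There the claim is trivial because of
        the factor \<open>norm z\<close>.\<close>
      have z_pole: "z \<notin> \<int>\<^sub>\<le>\<^sub>0"
        using assms z False by (auto elim!: nonpos_Ints_cases')
      have z1_pole: "z + 1 \<notin> \<int>\<^sub>\<le>\<^sub>0"
        using assms z by (auto elim!: nonpos_Ints_cases' simp: complex_eq_iff)
      have factor: "norm ((z + of_nat j) * (z + 1 + of_nat j)) \<le>
          (1 + h j) * norm ((z + of_real s + of_nat j) * (z + of_real (1 - s) + of_nat j))" for j
      proof -
        let ?u = "z + of_real s + of_nat j" and ?v = "z + of_real (1 - s) + of_nat j"
        have "j + \<eta> \<le> norm ?u" "j + \<eta> \<le> norm ?v"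
          using z by (auto intro!: order_trans[OF _ complex_Re_le_cmod] simp: \<eta>_def min_def)
        then have "(j + \<eta>) ^ 2 \<le> norm (?u * ?v)"
          using \<eta> unfolding norm_mult power2_eq_square by (intro mult_mono) auto
        then have "c \<le> h j * norm (?u * ?v)"
          using \<eta> c mult_left_mono[of "(j + \<eta>) ^ 2" "norm (?u * ?v)" c]
          by (auto simp: h_def field_simps)
        moreover have "(z + of_nat j) * (z + 1 + of_nat j) = ?u * ?v - of_real c"
          by (simp add: c_def algebra_simps)
        then have "norm ((z + of_nat j) * (z + 1 + of_nat j)) \<le> norm (?u * ?v) + c"
          using norm_triangle_ineq4[of "?u * ?v" "of_real c"] c by simp
        ultimately show ?thesis by (simp add: algebra_simps)
      qed
      have ineq: "norm (?G (z + of_real s) n * ?G (z + of_real (1 - s)) n) \<le>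
          exp (suminf h) * norm (?G z n * ?G (z + 1) n)" for n
      proof -
        let ?p = "\<lambda>w. pochhammer w n"
        have "norm (?p z * ?p (z + 1)) = (\<Prod>j<n. norm ((z + of_nat j) * (z + 1 + of_nat j)))"
          by (simp add: pochhammer_prod prod_norm flip: prod.distrib lessThan_atLeast0)
        also have "\<dots> \<le> (\<Prod>j<n. (1 + h j) *
            norm ((z + of_real s + of_nat j) * (z + of_real (1 - s) + of_nat j)))"
          by (intro prod_mono conjI factor) auto
        also have "\<dots> = (\<Prod>j<n. 1 + h j) * norm (?p (z + of_real s) * ?p (z + of_real (1 - s)))"
          by (simp only: pochhammer_prod prod_norm[symmetric] prod.distrib norm_mult lessThan_atLeast0)
        also have "\<dots> \<le> exp (suminf h) * norm (?p (z + of_real s) * ?p (z + of_real (1 - s)))"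
        proof (intro mult_right_mono norm_ge_zero)
          have "(\<Prod>j<n. 1 + h j) \<le> exp (\<Sum>j<n. h j)"
            by (rule prod_le_exp_sum) (rule h_nonneg)
          also have "\<dots> \<le> exp (suminf h)"
            using sum_le_suminf[OF \<open>summable h\<close>, of "{..<n}"] h_nonneg by simp
          finally show "(\<Prod>j<n. 1 + h j) \<le> exp (suminf h)" .
        qed
        finally have le: "norm (?p z * ?p (z + 1)) \<le>
            exp (suminf h) * norm (?p (z + of_real s) * ?p (z + of_real (1 - s)))" .
        have nz: "?p z * ?p (z + 1) \<noteq> 0"
          using z_pole z1_pole by (auto dest: pochhammer_eq_0_imp_nonpos_Int)
        have pos: "?p (z + of_real s) * ?p (z + of_real (1 - s)) \<noteq> 0"
          using le nz by auto
        \<comment> \<open>Both pairs of arguments add up to \<open>2 * z + 1\<close>. The two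
          products of approximants therefore share the numerator \<open>X\<close>, and only
          Pochhammer symbols remain to be compared.\<close>
        have E: "exp ((z + of_real s) * w) * exp ((z + of_real (1 - s)) * w) =
            exp (z * w) * exp ((z + 1) * w)" for w
          unfolding exp_add[symmetric] by (simp add: algebra_simps)
        define X where "X = fact (n - 1) * fact (n - 1) *
          (exp (z * of_real (ln (of_nat n))) * exp ((z + 1) * of_real (ln (of_nat n))))"
        have 1: "?G (z + of_real s) n * ?G (z + of_real (1 - s)) n =
            X / (?p (z + of_real s) * ?p (z + of_real (1 - s)))"
          unfolding X_def E[symmetric] by (simp add: Gamma_series'_def)
        have 2: "?G z n * ?G (z + 1) n = X / (?p z * ?p (z + 1))"
          by (simp add: Gamma_series'_def X_def)
        have "norm X * norm (?p z * ?p (z + 1)) \<le> norm X *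
            (exp (suminf h) * norm (?p (z + of_real s) * ?p (z + of_real (1 - s))))"
          by (intro mult_left_mono le) simp
        moreover have "0 < norm (?p z * ?p (z + 1))"
            "0 < norm (?p (z + of_real s) * ?p (z + of_real (1 - s)))"
          using nz pos by simp_all
        ultimately show ?thesis
          unfolding 1 2 norm_divide times_divide_eq_right
          by (subst divide_le_eq, simp) (simp add: pos_le_divide_eq mult_ac)
      qed
      have "(\<lambda>n. norm (?G (z + of_real s) n * ?G (z + of_real (1 - s)) n)) \<longlonglongrightarrow>
          norm (Gamma (z + of_real s) * Gamma (z + of_real (1 - s)))"
        by (intro tendsto_norm tendsto_mult Gamma_series'_LIMSEQ)
      moreover have "(\<lambda>n. exp (suminf h) * norm (?G z n * ?G (z + 1) n)) \<longlonglongrightarrow>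
          exp (suminf h) * norm (Gamma z * Gamma (z + 1))"
        by (intro tendsto_norm tendsto_mult tendsto_const Gamma_series'_LIMSEQ)
      ultimately have "norm (Gamma (z + of_real s) * Gamma (z + of_real (1 - s))) \<le>
          exp (suminf h) * norm (Gamma z * Gamma (z + 1))"
        by (rule LIMSEQ_le) (use ineq in blast)
      \<comment> \<open>The factor \<open>norm z\<close> turns \<open>Gamma z\<close> into
        \<open>Gamma (z + 1)\<close>, which is regular at \<open>0\<close>.\<close>
      then have "norm (Gamma (z + of_real s) * Gamma (z + of_real (1 - s))) * norm z \<le>
          exp (suminf h) * norm (Gamma z * Gamma (z + 1)) * norm z"
        by (intro mult_right_mono) simp_all
      then show ?thesis
        using Gamma_plus1[OF z_pole] by (simp add: norm_mult power2_eq_square mult_ac)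
    qed simp
  qed simp
qed

text \<open>With \<open>z = - \<sigma>\<close>, the multiplication formula for \<open>m = 5\<close>
  splits \<open>Gamma (1 - 5 * \<sigma>)\<close> into an exponential, \<open>Gamma (z + 1)\<close>
  and the values of \<open>Gamma\<close> at \<open>z + k / 5\<close> for
  \<open>k = 1, ..., 4\<close>. Pairing 1/5 with 4/5 and 2/5 with 3/5, each pair costs
  \<open>Gamma (z + 1) ^ 2\<close> and gains one factor \<open>1 / norm z\<close>. The five powers
  of \<open>Gamma (z + 1)\<close> cancel against \<open>rGamma (1 - \<sigma>) ^ 5\<close>. The
  condition \<open>\<delta> < 1 / 5\<close> is what the pair bound asks for at
  \<open>s = 1/5\<close>.\<close>

lemma Gamma_quintic_ratio_bound:
  assumes "\<delta> < 1 / 5"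
  obtains C where "C \<ge> 0" and "\<And>\<sigma>. Re \<sigma> \<le> \<delta> \<Longrightarrow>
    norm (Gamma (1 - 5 * \<sigma>) * rGamma (1 - \<sigma>) ^ 5) * norm \<sigma> ^ 2 \<le> C * exp (- 5 * ln 5 * Re \<sigma>)"
proof -
  obtain K :: complex where K: "\<And>z. 5 * z \<notin> \<int>\<^sub>\<le>\<^sub>0 \<Longrightarrow>
      Gamma (5 * z) = K * exp (5 * z * of_real (ln 5)) * (\<Prod>k<5. Gamma (z + of_nat k / 5))"
    using Gamma_multiplication[of 5] by auto
  obtain C1 where C1: "C1 \<ge> 0" "\<And>z::complex. - \<delta> \<le> Re z \<Longrightarrow>
      norm (Gamma (z + of_real (1/5)) * Gamma (z + of_real (1 - 1/5))) * norm z \<le> C1 * norm (Gamma (z + 1)) ^ 2"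
    using Gamma_pair_bound[of \<delta> "1/5"] assms by auto
  obtain C2 where C2: "C2 \<ge> 0" "\<And>z::complex. - \<delta> \<le> Re z \<Longrightarrow>
      norm (Gamma (z + of_real (2/5)) * Gamma (z + of_real (1 - 2/5))) * norm z \<le> C2 * norm (Gamma (z + 1)) ^ 2"
    using Gamma_pair_bound[of \<delta> "2/5"] assms by auto
  show thesis
  proof (rule that[of "5 * norm K * (C1 * C2)"])
    fix \<sigma> :: complex assume \<sigma>: "Re \<sigma> \<le> \<delta>"
    define z where "z = - \<sigma>"
    have z: "- \<delta> \<le> Re z" using \<sigma> by (simp add: z_def)
    show "norm (Gamma (1 - 5 * \<sigma>) * rGamma (1 - \<sigma>) ^ 5) * norm \<sigma> ^ 2 \<le>
        5 * norm K * (C1 * C2) * exp (- 5 * ln 5 * Re \<sigma>)"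
    proof (cases "\<sigma> = 0")
      case False
      let ?A = "Gamma (z + of_real (1/5)) * Gamma (z + of_real (1 - 1/5))"
      let ?B = "Gamma (z + of_real (2/5)) * Gamma (z + of_real (1 - 2/5))"
      \<comment> \<open>From \<open>Re z \<ge> - \<delta> > - 1 / 5\<close>, the only candidate is
        \<open>z = 0\<close>, which this case excludes.\<close>
      have pole: "5 * z \<notin> \<int>\<^sub>\<le>\<^sub>0"
      proof
        assume "5 * z \<in> \<int>\<^sub>\<le>\<^sub>0"
        then obtain n where n: "5 * z = - of_nat n"
          by (auto elim!: nonpos_Ints_cases')
        then have "5 * Re z = - real n" "Im z = 0"
          by (auto simp: complex_eq_iff)
        moreover from this have "n = 0"
          using z assms by simp
        ultimately show False
          using False by (simp add: z_def complex_eq_iff)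
      qed
      then have pole': "z \<notin> \<int>\<^sub>\<le>\<^sub>0"
        using Nats_mult_nonpos_Ints[of 5 z] by auto
      have "1 - \<sigma> \<notin> \<int>\<^sub>\<le>\<^sub>0"
        using \<sigma> assms by (intro Re_pos_not_nonpos_Ints) simp
      then have g: "Gamma (z + 1) \<noteq> 0" "rGamma (1 - \<sigma>) = 1 / Gamma (z + 1)"
        by (simp_all add: Gamma_eq_zero_iff z_def rGamma_inverse_Gamma inverse_eq_divide)
      have "Gamma (1 - 5 * \<sigma>) = 5 * z * Gamma (5 * z)"
        using Gamma_plus1[OF pole] by (simp add: z_def)
      also have "\<dots> = 5 * K * exp (5 * z * of_real (ln 5)) * (z * Gamma z) * (?A * ?B)"
        unfolding K[OF pole] by (simp add: eval_nat_numeral mult_ac)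
      finally have G: "Gamma (1 - 5 * \<sigma>) =
          5 * K * exp (5 * z * of_real (ln 5)) * Gamma (z + 1) * (?A * ?B)"
        by (simp only: Gamma_plus1[OF pole'])
      have "norm (?A * ?B) * norm z ^ 2 = (norm ?A * norm z) * (norm ?B * norm z)"
        by (simp add: norm_mult power2_eq_square)
      also have "\<dots> \<le> (C1 * norm (Gamma (z + 1)) ^ 2) * (C2 * norm (Gamma (z + 1)) ^ 2)"
        using C1(1) by (intro mult_mono C1(2) C2(2) z) auto
      finally have AB: "norm (?A * ?B) * norm z ^ 2 \<le> C1 * C2 * norm (Gamma (z + 1)) ^ 4"
        by (simp add: power2_eq_square eval_nat_numeral mult_ac)
      have "norm (Gamma (1 - 5 * \<sigma>) * rGamma (1 - \<sigma>) ^ 5) * norm \<sigma> ^ 2 =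
          5 * norm K * exp (- 5 * ln 5 * Re \<sigma>) * (norm (?A * ?B) * norm z ^ 2) / norm (Gamma (z + 1)) ^ 4"
        using g(1) unfolding G g(2)
        by (simp add: norm_mult norm_divide norm_power z_def eval_nat_numeral field_simps)
      also have "\<dots> \<le> 5 * norm K * exp (- 5 * ln 5 * Re \<sigma>) *
          (C1 * C2 * norm (Gamma (z + 1)) ^ 4) / norm (Gamma (z + 1)) ^ 4"
        by (intro divide_right_mono mult_left_mono AB) auto
      also have "\<dots> = 5 * norm K * (C1 * C2) * exp (- 5 * ln 5 * Re \<sigma>)"
        using g(1) by simp
      finally show ?thesis .
    qed (use C1 C2 in simp)
  qed (use C1 C2 in simp)
qed

section \<open>Shifting a vertical line of integration\<close>

text \<open>Contour integrals over vertical segments appear as gauge integrals over bounded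
  intervals. Dominated convergence, with \<open>norm (f t)\<close> as majorant, connects them to the
  Lebesgue integral over the whole line.\<close>

lemma integral_symmetric_interval_LIMSEQ:
  fixes f :: "real \<Rightarrow> complex"
  assumes "integrable lborel f"
  shows "(\<lambda>n. integral {- real n..real n} f) \<longlonglongrightarrow> (LINT t|lborel. f t)"
proof -
  have "integral {- real n..real n} f = (LINT t|lborel. indicator {- real n..real n} t *\<^sub>R f t)" for n
  proof -
    have "set_integrable lborel {- real n..real n} f"
      unfolding set_integrable_def by (intro integrable_mult_indicator assms) auto
    from set_borel_integral_eq_integral(2)[OF this] show ?thesis
      by (simp add: set_lebesgue_integral_def)
  qed
  moreover have "(\<lambda>n. LINT t|lborel. indicator {- real n..real n} t *\<^sub>R f t) \<longlonglongrightarrow> (LINT t|lborel. f t)"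
  proof (rule integral_dominated_convergence)
    show "AE t in lborel. (\<lambda>n. indicator {- real n..real n} t *\<^sub>R f t) \<longlonglongrightarrow> f t"
    proof (rule AE_I2)
      fix t :: real
      obtain N :: nat where N: "\<bar>t\<bar> \<le> real N"
        using real_arch_simple by blast
      have "\<forall>\<^sub>F n in sequentially. indicator {- real n..real n} t *\<^sub>R f t = f t"
        using eventually_ge_at_top[of N] by eventually_elim (use N in \<open>auto simp: indicator_def\<close>)
      then show "(\<lambda>n. indicator {- real n..real n} t *\<^sub>R f t) \<longlonglongrightarrow> f t"
        by (rule tendsto_eventually)
    qed
    show "integrable lborel (\<lambda>t. norm (f t))"
      using assms by simp
    show "AE t in lborel. norm (indicator {- real n..real n} t *\<^sub>R f t) \<le> norm (f t)" for n
      by (auto simp: indicator_def)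
  qed (use assms in \<open>auto intro!: borel_measurable_integrable integrable_mult_indicator\<close>)
  ultimately show ?thesis by simp
qed

text \<open>The residue theorem is applied to rectangles of half-height \<open>n\<close>. Their
  horizontal sides have fixed length \<open>b - a\<close> and \<open>f\<close> is at most
  \<open>\<bar>M\<bar> / n\<close> there, so they contribute nothing in the limit. The wider strip
  from \<open>a'\<close> to \<open>b'\<close> is an open set around the closed rectangles. The
  factor is \<open>2 * pi\<close> without \<i> because the line integrals are taken in
  \<open>dt\<close>, not in the complex differential.\<close>

lemma integral_vertical_line_shift:
  fixes f :: "complex \<Rightarrow> complex"
  assumes ab: "a' < a" "a < b" "b < b'"
    and P: "finite P" "\<And>p. p \<in> P \<Longrightarrow> a < Re p \<and> Re p < b"
    and holo: "f holomorphic_on {z. a' < Re z \<and> Re z < b'} - P"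
    and decay: "\<And>z. a \<le> Re z \<Longrightarrow> Re z \<le> b \<Longrightarrow> 1 \<le> \<bar>Im z\<bar> \<Longrightarrow> norm (f z) * \<bar>Im z\<bar> \<le> M"
    and int: "integrable lborel (\<lambda>t. f (Complex a t))" "integrable lborel (\<lambda>t. f (Complex b t))"
  shows "(LINT t|lborel. f (Complex b t)) =
    (LINT t|lborel. f (Complex a t)) + 2 * of_real pi * (\<Sum>p\<in>P. residue f p)"
proof -
  let ?S = "{z. a' < Re z \<and> Re z < b'}"
  define V where "V c n = integral {- real n..real n} (\<lambda>t. f (Complex c t))" for c and n :: nat
  define H where "H n = contour_integral (linepath (Complex a (- real n)) (Complex b (- real n))) f +
    contour_integral (linepath (Complex b (real n)) (Complex a (real n))) f" for n
  define r where "r = 2 * of_real pi * (\<Sum>p\<in>P. residue f p)"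
  \<comment> \<open>From half-height \<open>N\<close> on, the rectangle encloses all of
    \<open>P\<close>.\<close>
  obtain N :: nat where N: "N \<ge> 1" "\<And>p. p \<in> P \<Longrightarrow> \<bar>Im p\<bar> < real N"
  proof -
    obtain R where R: "\<And>p. p \<in> P \<Longrightarrow> norm p \<le> R"
      using finite_imp_bounded[OF P(1)] by (auto simp: bounded_iff)
    obtain N :: nat where "R < real N"
      using reals_Archimedean2 by blast
    then have "\<bar>Im p\<bar> < real (Suc N)" if "p \<in> P" for p
      using R[OF that] abs_Im_le_cmod[of p] by simp
    then show thesis
      by (intro that[of "Suc N"]) auto
  qed
  have S: "open ?S" "convex ?S"
  proof -
    have "?S = {z. a' < Re z} \<inter> {z. Re z < b'}" by auto
    then show "open ?S" "convex ?S"
      by (auto intro!: open_Int open_halfspace_Re_gt open_halfspace_Re_lt convex_Int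
          convex_halfspace_Re_gt convex_halfspace_Re_lt)
  qed
  have step: "\<i> * V b n - \<i> * V a n + H n = \<i> * r \<and> norm (H n) \<le> 2 * (\<bar>M\<bar> * (b - a)) / real n"
    if n: "n \<ge> N" for n
  proof -
    have n1: "real n \<ge> 1" using n N(1) by linarith
    let ?ll = "Complex a (- real n)" and ?lr = "Complex b (- real n)"
      and ?ur = "Complex b (real n)" and ?ul = "Complex a (real n)"
    let ?g = "rectpath ?ll ?ur"
    have box: "p \<in> box ?ll ?ur" if "p \<in> P" for p
      using P(2)[OF that] N(2)[OF that] n by (auto simp: in_box_complex_iff)
    have img: "path_image ?g \<subseteq> ?S - P"
    proof -
      have "path_image ?g = cbox ?ll ?ur - box ?ll ?ur"
        using ab n1 by (intro path_image_rectpath_cbox_minus_box) auto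
      then show ?thesis
        using ab box by (auto simp: in_cbox_complex_iff)
    qed
    have "contour_integral ?g f = 2 * pi * \<i> * (\<Sum>p\<in>P. winding_number ?g p * residue f p)"
    proof (rule Residue_theorem[of ?S P f])
      show "\<forall>z. z \<notin> ?S \<longrightarrow> winding_number ?g z = 0"
        using ab n1 by (auto intro!: winding_number_rectpath_outside simp: in_cbox_complex_iff)
    qed (use S P holo img in \<open>auto intro: convex_connected\<close>)
    also have "\<dots> = \<i> * r"
      by (simp add: r_def winding_number_rectpath[OF box])
    finally have g: "contour_integral ?g f = \<i> * r" .
    have cont: "continuous_on (?S - P) f"
      by (rule holomorphic_on_imp_continuous_on[OF holo])
    have sub: "closed_segment ?ll ?lr \<subseteq> ?S - P" "closed_segment ?lr ?ur \<subseteq> ?S - P"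
        "closed_segment ?ur ?ul \<subseteq> ?S - P" "closed_segment ?ul ?ll \<subseteq> ?S - P"
      using img by (auto simp: rectpath_def Let_def path_image_join)
    note ci = contour_integrable_continuous_linepath[OF continuous_on_subset[OF cont]]
    have ci: "f contour_integrable_on linepath ?ll ?lr" "f contour_integrable_on linepath ?lr ?ur"
        "f contour_integrable_on linepath ?ur ?ul" "f contour_integrable_on linepath ?ul ?ll"
      by (rule ci; rule sub)+
    have "contour_integral ?g f = contour_integral (linepath ?ll ?lr) f +
        (contour_integral (linepath ?lr ?ur) f +
        (contour_integral (linepath ?ur ?ul) f + contour_integral (linepath ?ul ?ll) f))"
      using ci by (simp add: rectpath_def Let_def)
    moreover have "contour_integral (linepath ?lr ?ur) f = \<i> * V b n"
      unfolding V_def using n1 by (intro contour_integral_linepath_same_Re) auto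
    \<comment> \<open>The left side is traversed downwards and is reversed to match the upward
      parametrization in \<open>V\<close>.\<close>
    moreover have "contour_integral (linepath ?ul ?ll) f = - contour_integral (linepath ?ll ?ul) f"
      using ci(4) by (subst contour_integral_reverse_linepath) (auto intro!: continuous_on_subset[OF cont] sub simp: closed_segment_commute)
    moreover have "contour_integral (linepath ?ll ?ul) f = \<i> * V a n"
      unfolding V_def using n1 by (intro contour_integral_linepath_same_Re) auto
    ultimately have 1: "\<i> * V b n - \<i> * V a n + H n = \<i> * r"
      using g by (simp add: H_def algebra_simps)
    have bound: "norm (f z) \<le> \<bar>M\<bar> / real n" if "a \<le> Re z" "Re z \<le> b" "\<bar>Im z\<bar> = real n" for z
      using decay[of z] that n1 by (simp add: pos_le_divide_eq)
    have bounds: "norm (contour_integral (linepath (Complex c y) (Complex d y)) f) \<le>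
        \<bar>M\<bar> / real n * norm (Complex d y - Complex c y)"
      if "f contour_integrable_on linepath (Complex c y) (Complex d y)" "\<bar>y\<bar> = real n"
        "{c, d} = {a, b}" for c d y
      using that ab
      by (intro contour_integral_bound_linepath that bound)
        (auto simp: closed_segment_same_Im closed_segment_eq_real_ivl doubleton_eq_iff)
    have nrm: "norm (Complex b y - Complex a y) = b - a" "norm (Complex a y - Complex b y) = b - a" for y
      using ab by (simp_all add: cmod_def)
    have "norm (H n) \<le> \<bar>M\<bar> / real n * (b - a) + \<bar>M\<bar> / real n * (b - a)"
      unfolding H_def using bounds[OF ci(1)] bounds[OF ci(3)]
      by (intro order_trans[OF norm_triangle_ineq] add_mono) (auto simp: nrm insert_commute)
    with 1 show ?thesis by (simp add: field_simps)
  qed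
  have "H \<longlonglongrightarrow> 0"
  proof (rule Lim_null_comparison)
    show "\<forall>\<^sub>F n in sequentially. norm (H n) \<le> 2 * (\<bar>M\<bar> * (b - a)) / real n"
      using eventually_ge_at_top[of N] by eventually_elim (use step in blast)
    show "(\<lambda>n. 2 * (\<bar>M\<bar> * (b - a)) / real n) \<longlonglongrightarrow> 0"
      by (rule lim_const_over_n)
  qed
  moreover have "V b \<longlonglongrightarrow> (LINT t|lborel. f (Complex b t))" "V a \<longlonglongrightarrow> (LINT t|lborel. f (Complex a t))"
    unfolding V_def by (intro integral_symmetric_interval_LIMSEQ int)+
  ultimately have "(\<lambda>n. \<i> * V b n - \<i> * V a n + H n) \<longlonglongrightarrow>
      \<i> * (LINT t|lborel. f (Complex b t)) - \<i> * (LINT t|lborel. f (Complex a t)) + 0"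
    by (intro tendsto_intros)
  moreover have "(\<lambda>n. \<i> * V b n - \<i> * V a n + H n) \<longlonglongrightarrow> \<i> * r"
    by (rule tendsto_eventually, rule eventually_mono[OF eventually_ge_at_top[of N]])
      (use step in blast)
  ultimately have "\<i> * (LINT t|lborel. f (Complex b t)) - \<i> * (LINT t|lborel. f (Complex a t)) + 0 = \<i> * r"
    by (rule LIMSEQ_unique)
  then have "\<i> * ((LINT t|lborel. f (Complex b t)) - (LINT t|lborel. f (Complex a t))) = \<i> * r"
    by (simp add: right_diff_distrib)
  then have "(LINT t|lborel. f (Complex b t)) - (LINT t|lborel. f (Complex a t)) = r"
    by simp
  then show ?thesis
    by (simp add: r_def diff_eq_eq add.commute)
qed

section \<open>The integrand of the brane\<close>

text \<open>Summing over any finite set containing the support allows two classes to be compared on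
  a common index set, which yields additivity although supports may cancel.\<close>

lemma Ch_eq_sum:
  assumes "finite A" "Poly_Mapping.keys \<kappa> \<subseteq> A"
  shows "Ch \<kappa> \<sigma> = (\<Sum>\<eta>\<in>A. of_int (Poly_Mapping.lookup \<kappa> \<eta>) *
           exp (2 * of_real pi * \<i> * of_int (fst \<eta>) * \<sigma>))"
  unfolding Ch_def using assms by (intro sum.mono_neutral_left) (auto simp: in_keys_iff)

lemma Ch_add: "Ch (\<kappa> + \<kappa>') \<sigma> = Ch \<kappa> \<sigma> + Ch \<kappa>' \<sigma>"
  using keys_add[of \<kappa> \<kappa>']
  by (simp add: Ch_eq_sum[of "Poly_Mapping.keys \<kappa> \<union> Poly_Mapping.keys \<kappa>'"] lookup_add
      algebra_simps flip: sum.distrib)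

lemma Ch_diff: "Ch (\<kappa> - \<kappa>') \<sigma> = Ch \<kappa> \<sigma> - Ch \<kappa>' \<sigma>"
  using Ch_add[of "\<kappa> - \<kappa>'" \<kappa>' \<sigma>] by simp

lemma Ch_sum: "Ch (\<Sum>e\<in>A. \<kappa> e) \<sigma> = (\<Sum>e\<in>A. Ch (\<kappa> e) \<sigma>)"
  by (induction A rule: infinite_finite_induct) (simp_all add: Ch_add, simp_all add: Ch_def)

lemma Ch_single: "Ch (Poly_Mapping.single \<eta> n) \<sigma> =
    of_int n * exp (2 * of_real pi * \<i> * of_int (fst \<eta>) * \<sigma>)"
  by (simp add: Ch_eq_sum[of "{\<eta>}"] lookup_single)

text \<open>The basis element \<open>S\<close> of the Koszul complex contributes
  \<open>q ^ card S\<close> with sign \<open>(-1) ^ card S\<close>, so the alternating sum over all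
  subsets is the expansion of \<open>(1 - q) ^ 5\<close>. The prefactor is the character of the
  twist.\<close>

lemma Ch_forget_brane:
  "Ch (forget brane) \<sigma> = exp (4 * of_real pi * \<i> * \<sigma>) * (1 - exp (- 2 * of_real pi * \<i> * \<sigma>)) ^ 5"
proof -
  define q where "q = exp (- 2 * of_real pi * \<i> * \<sigma>)"
  have q_pow: "exp (2 * of_real pi * \<i> * of_int (2 - int k) * \<sigma>) =
      exp (4 * of_real pi * \<i> * \<sigma>) * q ^ k" for k
    by (simp add: q_def algebra_simps flip: exp_of_nat_mult exp_add)
  have "(\<Sum>i\<in>S. line_bundle 1) = line_bundle (int (card S))" for S :: "5 set"
    by (induction S rule: infinite_finite_induct) (simp_all add: line_bundle_def zero_prod_def)
  then have chr: "Ch (Poly_Mapping.single (line_bundle 2 - (\<Sum>i\<in>S. line_bundle 1)) 1) \<sigma> =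
      exp (4 * of_real pi * \<i> * \<sigma>) * q ^ card S" for S :: "5 set"
    by (simp add: Ch_single line_bundle_def flip: q_pow)
  have "Ch (forget brane) \<sigma> =
      (\<Sum>S\<in>{S::5 set. even (card S)}. exp (4 * of_real pi * \<i> * \<sigma>) * q ^ card S) -
      (\<Sum>S\<in>{S::5 set. odd (card S)}. exp (4 * of_real pi * \<i> * \<sigma>) * q ^ card S)"
    by (simp add: forget_def bundle_class_def brane_def brane0_def twist_def twist_bundle_def
        koszul_def Ch_diff Ch_sum chr)
  also have "\<dots> = (\<Sum>S\<in>{S::5 set. even (card S)} \<union> {S. odd (card S)}.
      exp (4 * of_real pi * \<i> * \<sigma>) * ((- 1) ^ card S * q ^ card S))"
    by (subst sum.union_disjoint) (auto simp: sum_negf[symmetric])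
  also have "{S::5 set. even (card S)} \<union> {S. odd (card S)} = Pow UNIV"
    by auto
  also have "(\<Sum>S\<in>Pow (UNIV :: 5 set). exp (4 * of_real pi * \<i> * \<sigma>) * ((- 1) ^ card S * q ^ card S)) =
      exp (4 * of_real pi * \<i> * \<sigma>) * (\<Prod>i\<in>(UNIV :: 5 set). 1 - q)"
    by (subst prod_diff_conv_sum) (simp_all add: sum_distrib_left)
  finally show ?thesis by (simp add: q_def)
qed

text \<open>Up to a constant this is the integrand continued to the left of its strip. The
  fifth-order poles of \<open>Gamma \<sigma> ^ 5\<close> have been cancelled against the fifth power
  of the sine in the Chern character. Since \<open>rGamma\<close> is entire, only the zeros of the
  cosine are singular in \<open>Re \<sigma> < 1 / 5\<close>.\<close>

definition quintic_kernel :: "complex \<Rightarrow> complex \<Rightarrow> complex" where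
  "quintic_kernel \<theta> \<sigma> = Gamma (1 - 5 * \<sigma>) * rGamma (1 - \<sigma>) ^ 5 *
     exp ((\<theta> - of_real pi * \<i>) * \<sigma>) / cos (of_real pi * \<sigma>)"

lemma prod_coord: "(\<Prod>i\<in>UNIV. h i) = (\<Prod>i\<in>UNIV. h (Cx i)) * h Cp * h Cu * h Cv"
  for h :: "coord \<Rightarrow> complex"
proof -
  have "(\<Prod>i\<in>UNIV. h i) = (\<Prod>i\<in>range Cx. h i) * (\<Prod>i\<in>{Cp, Cu, Cv}. h i)"
    unfolding UNIV_coord by (rule prod.union_disjoint) auto
  also have "(\<Prod>i\<in>range Cx. h i) = (\<Prod>i\<in>UNIV. h (Cx i))"
    by (subst prod.reindex) (auto simp: inj_on_def)
  finally show ?thesis by (simp add: mult_ac)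
qed

lemma hemisphere_integrand_brane:
  assumes "0 < Re \<sigma>" "Re \<sigma> < 1 / 5"
  shows "hemisphere_integrand brane \<theta> \<sigma> = 32 * \<i> * of_real pi ^ 6 * quintic_kernel \<theta> \<sigma>"
proof -
  let ?p = "of_real pi :: complex"
  have notint: "\<sigma> \<notin> \<int>"
    using assms by (auto elim!: Ints_cases)
  have sin_nz: "sin (?p * \<sigma>) \<noteq> 0"
  proof
    assume "sin (?p * \<sigma>) = 0"
    then obtain n :: int where "?p * \<sigma> = of_int n * ?p"
      by (auto simp: sin_eq_0)
    then have "\<sigma> = of_int n" by simp
    with notint show False by simp
  qed
  have "Gamma \<sigma> * Gamma (1 - \<sigma>) = ?p / sin (?p * \<sigma>)"
    by (rule Gamma_reflection_complex)
  moreover have "1 - \<sigma> \<notin> \<int>\<^sub>\<le>\<^sub>0"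
    using assms by (auto elim!: nonpos_Ints_cases' simp: complex_eq_iff)
  ultimately have x: "Gamma \<sigma> * sin (?p * \<sigma>) = ?p * rGamma (1 - \<sigma>)"
    using sin_nz by (simp add: rGamma_inverse_Gamma Gamma_eq_zero_iff field_simps)
  have p6: "?p ^ 6 = ?p ^ 5 * ?p"
    by (simp add: eval_nat_numeral)
  \<comment> \<open>The two coordinates \<open>Cu\<close> and \<open>Cv\<close> together give the
    reflection formula at \<open>\<sigma> + 1 / 2\<close>.\<close>
  have uv: "Gamma (\<sigma> + 1 / 2) * Gamma (- \<sigma> + 1 / 2) = ?p / cos (?p * \<sigma>)"
    using Gamma_reflection_complex[of "\<sigma> + 1 / 2"]
    by (simp add: algebra_simps sin_add)
  \<comment> \<open>Symmetrizing each of the five factors into a sine uses up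
    \<open>exp (\<i> * pi * \<sigma>)\<close>. The twist supplies four of these, which leaves the
    phase \<open>exp (- pi * \<i> * \<sigma>)\<close>.\<close>
  have "exp (4 * ?p * \<i> * \<sigma>) * (1 - exp (- 2 * ?p * \<i> * \<sigma>)) ^ 5 =
      exp (- (?p * \<i>) * \<sigma>) * (exp (\<i> * (?p * \<sigma>)) - exp (- (\<i> * (?p * \<sigma>)))) ^ 5"
  proof -
    have "exp (\<i> * (?p * \<sigma>)) - exp (- (\<i> * (?p * \<sigma>))) =
        exp (\<i> * (?p * \<sigma>)) * (1 - exp (- 2 * ?p * \<i> * \<sigma>))"
      by (simp add: algebra_simps flip: exp_add)
    moreover have "exp (- (?p * \<i>) * \<sigma>) * exp (\<i> * (?p * \<sigma>)) ^ 5 = exp (4 * ?p * \<i> * \<sigma>)"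
      unfolding exp_of_nat_mult[symmetric] exp_add[symmetric] by (simp add: algebra_simps)
    ultimately show ?thesis
      by (simp only: power_mult_distrib) (simp only: mult.assoc[symmetric])
  qed
  also have "exp (\<i> * (?p * \<sigma>)) - exp (- (\<i> * (?p * \<sigma>))) = 2 * \<i> * sin (?p * \<sigma>)"
    by (simp add: sin_exp_eq)
  finally have "exp (4 * ?p * \<i> * \<sigma>) * (1 - exp (- 2 * ?p * \<i> * \<sigma>)) ^ 5 =
      exp (- (?p * \<i>) * \<sigma>) * (2 * \<i> * sin (?p * \<sigma>)) ^ 5" .
  moreover have i5: "(2 * \<i> * y) ^ 5 = 32 * \<i> * y ^ 5" for y
    by (simp add: power_mult_distrib) (simp add: eval_nat_numeral)
  ultimately have ch: "Ch (forget brane) \<sigma> = 32 * \<i> * exp (- (?p * \<i>) * \<sigma>) * sin (?p * \<sigma>) ^ 5"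
    by (simp add: Ch_forget_brane i5)
  have "hemisphere_integrand brane \<theta> \<sigma> = Gamma \<sigma> ^ 5 * Gamma (1 - 5 * \<sigma>) *
      (Gamma (\<sigma> + 1 / 2) * Gamma (- \<sigma> + 1 / 2)) * exp (\<theta> * \<sigma>) * Ch (forget brane) \<sigma>"
    by (simp add: hemisphere_integrand_def prod_coord weight_def mult_ac)
  also have "\<dots> = 32 * \<i> * (Gamma \<sigma> * sin (?p * \<sigma>)) ^ 5 * Gamma (1 - 5 * \<sigma>) *
      (?p / cos (?p * \<sigma>)) * (exp (\<theta> * \<sigma>) * exp (- (?p * \<i>) * \<sigma>))"
    unfolding uv ch by (simp add: power_mult_distrib mult_ac)
  also have "exp (\<theta> * \<sigma>) * exp (- (?p * \<i>) * \<sigma>) = exp ((\<theta> - ?p * \<i>) * \<sigma>)"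
    by (simp add: algebra_simps flip: exp_add)
  finally show ?thesis
    unfolding x power_mult_distrib p6 quintic_kernel_def by (simp add: mult_ac)
qed

lemma admissibleD:
  assumes "admissible \<delta>"
  shows "0 < \<delta>" "\<delta> < 1 / 5"
proof -
  have "Re (weight i (of_real \<delta>)) + of_int (R_charge i) / 2 > 0" for i
    using assms unfolding admissible_def by blast
  from this[of "Cx 0"] this[of Cp] show "0 < \<delta>" "\<delta> < 1 / 5"
    by (simp_all add: weight_def)
qed

section \<open>Gamma values at half-odd arguments, the source of the double factorials\<close>

lemma Gamma_half_odd:
  "Gamma (1 + of_nat (2 * k + 1) / 2 :: complex) =
     of_nat (double_fact (2 * k + 1)) * of_real (sqrt pi) / 2 ^ (k + 1)"
proof (induction k)
  case 0
  have "(1 / 2 :: complex) \<notin> \<int>\<^sub>\<le>\<^sub>0"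
    by (auto elim!: nonpos_Ints_cases' simp: complex_eq_iff)
  from Gamma_plus1[OF this] show ?case
    by (simp add: Gamma_one_half_complex)
next
  case (Suc k)
  let ?w = "1 + of_nat (2 * k + 1) / 2 :: complex"
  have "?w \<notin> \<int>\<^sub>\<le>\<^sub>0"
    by (rule Re_pos_not_nonpos_Ints) (simp add: add_pos_nonneg)
  then have "Gamma (?w + 1) = ?w * Gamma ?w"
    by (rule Gamma_plus1)
  moreover have "?w + 1 = 1 + of_nat (2 * Suc k + 1) / 2" "?w = of_nat (2 * k + 3) / 2"
    by (simp_all add: field_simps)
  moreover have "double_fact (2 * Suc k + 1) = (2 * k + 3) * double_fact (2 * k + 1)"
    by (simp add: numeral_eq_Suc)
  ultimately show ?case
    unfolding Suc by (simp add: field_simps)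
qed

text \<open>The powers of two, \<open>5 * k + 3\<close> below the numerator against
  \<open>5 * (k + 1)\<close> from the denominator, leave 4. One \<open>sqrt pi\<close> against five
  leaves \<open>1 / pi ^ 2\<close>.\<close>

lemma Gamma_quintic_ratio_half_odd:
  fixes k :: nat
  defines "d \<equiv> 2 * k + 1"
  shows "Gamma (1 + 5 * of_nat d / 2) * rGamma (1 + of_nat d / 2 :: complex) ^ 5 =
         4 / of_real pi ^ 2 * (of_nat (double_fact (5 * d)) / of_nat (double_fact d) ^ 5)"
proof -
  have 5: "5 * d = 2 * (5 * k + 2) + 1"
    by (simp add: d_def)
  have num: "Gamma (1 + 5 * of_nat d / 2 :: complex) =
      of_nat (double_fact (5 * d)) * of_real (sqrt pi) / 2 ^ (5 * k + 3)"
    using Gamma_half_odd[of "5 * k + 2"] unfolding 5[symmetric] by (simp add: power_add)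
  have den: "rGamma (1 + of_nat d / 2 :: complex) =
      2 ^ (k + 1) / (of_nat (double_fact d) * of_real (sqrt pi))"
    unfolding rGamma_inverse_Gamma d_def Gamma_half_odd by simp
  have pi: "(of_real (sqrt pi) :: complex) ^ 5 = of_real pi ^ 2 * of_real (sqrt pi)"
  proof -
    have "sqrt pi ^ 5 = (sqrt pi ^ 2) ^ 2 * sqrt pi"
      by (simp add: eval_nat_numeral)
    then have "sqrt pi ^ 5 = pi ^ 2 * sqrt pi" by simp
    then show ?thesis by (metis of_real_mult of_real_power)
  qed
  have pow: "((2 :: complex) ^ (k + 1)) ^ 5 = 4 * 2 ^ (5 * k + 3)"
    by (simp add: power_add power_mult_distrib flip: power_mult) (simp add: mult.commute)
  show ?thesis
    unfolding num den power_divide power_mult_distrib pi pow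
    by (simp add: field_simps)
qed

section \<open>Summing the residues\<close>

text \<open>Both bounds come from the formula for \<open>norm (cos z) ^ 2\<close> in terms of
  \<open>E = exp \<bar>Im z\<bar>\<close>. The first holds at every height but degenerates near the
  zeros, and serves vertical lines. The second is uniform in \<open>Re z\<close> away from the real
  axis, and serves horizontal segments.\<close>

lemma norm_cos_ge:
  "\<bar>cos (Re z)\<bar> * exp \<bar>Im z\<bar> / 2 \<le> norm (cos z)"
  "1 \<le> \<bar>Im z\<bar> \<Longrightarrow> exp \<bar>Im z\<bar> / 4 \<le> norm (cos z)"
proof -
  define E where "E = exp \<bar>Im z\<bar>"
  have E: "E \<ge> 1" by (simp add: E_def)
  have "(exp (Im z) - inverse (exp (Im z))) ^ 2 = (E - 1 / E) ^ 2"
    by (cases "Im z \<ge> 0") (auto simp: E_def exp_minus inverse_eq_divide power2_commute)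
  then have sq: "norm (cos z) ^ 2 = cos (Re z) ^ 2 + (E - 1 / E) ^ 2 / 4"
    by (simp add: norm_cos_squared)
  have "(\<bar>cos (Re z)\<bar> * E / 2) ^ 2 \<le> norm (cos z) ^ 2"
  proof -
    have "cos (Re z) ^ 2 * (E - 1 / E) ^ 2 \<le> 1 * (E - 1 / E) ^ 2"
      by (intro mult_right_mono) (auto simp: abs_square_le_1)
    moreover have "(E - 1 / E) ^ 2 + 4 = (E + 1 / E) ^ 2"
      using E by (simp add: field_simps power2_eq_square)
    moreover have "E ^ 2 \<le> (E + 1 / E) ^ 2"
      using E by (intro power_mono) auto
    then have "cos (Re z) ^ 2 * E ^ 2 \<le> cos (Re z) ^ 2 * (E + 1 / E) ^ 2"
      by (intro mult_left_mono) auto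
    moreover have "cos (Re z) ^ 2 * ((E - 1 / E) ^ 2 + 4) =
        cos (Re z) ^ 2 * (E - 1 / E) ^ 2 + 4 * cos (Re z) ^ 2"
      by (simp add: algebra_simps)
    ultimately have "cos (Re z) ^ 2 * E ^ 2 \<le> (E - 1 / E) ^ 2 + 4 * cos (Re z) ^ 2"
      by simp
    then show ?thesis
      unfolding sq by (simp add: power_mult_distrib power_divide)
  qed
  then show "\<bar>cos (Re z)\<bar> * exp \<bar>Im z\<bar> / 2 \<le> norm (cos z)"
    unfolding E_def by (rule power2_le_imp_le) simp
  assume "1 \<le> \<bar>Im z\<bar>"
  then have "E \<ge> 2"
    unfolding E_def using exp_ge_add_one_self[of "\<bar>Im z\<bar>"] by linarith
  then have "1 / E \<le> 1 / 2" by (simp add: field_simps)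
  with \<open>E \<ge> 2\<close> have "E / 2 \<le> E - 1 / E" by linarith
  then have "(E / 2) ^ 2 \<le> (E - 1 / E) ^ 2"
    using E by (intro power_mono) auto
  then have "(E / 4) ^ 2 \<le> norm (cos z) ^ 2"
    unfolding sq by (simp add: power_divide) (smt (verit) zero_le_power2)
  then show "exp \<bar>Im z\<bar> / 4 \<le> norm (cos z)"
    unfolding E_def by (rule power2_le_imp_le) simp
qed

text \<open>The exponential has modulus
  \<open>exp (\<zeta> * Re \<sigma> + pi * (1 - 2 * B) * Im \<sigma>)\<close>. Since
  \<open>\<bar>1 - 2 * B\<bar> \<le> 1\<close>, its growth in \<open>Im \<sigma>\<close> is absorbed
  by the cosine. Since \<open>\<zeta> \<ge> 5 * ln 5\<close>, its decay to the left absorbs the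
  growth of the Gamma quotient. What remains is the decay of order \<open>norm \<sigma>\<close> to
  the power -2.\<close>

lemma quintic_kernel_bound:
  fixes \<zeta> B \<delta> :: real and \<theta> :: complex
  assumes \<theta>: "\<theta> = of_real \<zeta> + 2 * of_real pi * \<i> * of_real B"
    and \<zeta>: "5 * ln 5 \<le> \<zeta>" and B: "0 \<le> B" "B \<le> 1" and \<delta>: "\<delta> < 1 / 5"
  obtains M where "M \<ge> 0"
    and "\<And>\<sigma>. Re \<sigma> \<le> \<delta> \<Longrightarrow>
      norm (quintic_kernel \<theta> \<sigma>) * norm \<sigma> ^ 2 * \<bar>cos (pi * Re \<sigma>)\<bar> \<le> M"
    and "\<And>\<sigma>. Re \<sigma> \<le> \<delta> \<Longrightarrow> 1 \<le> \<bar>Im \<sigma>\<bar> \<Longrightarrow> norm (quintic_kernel \<theta> \<sigma>) * norm \<sigma> ^ 2 \<le> M"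
proof -
  obtain C where C: "C \<ge> 0" "\<And>\<sigma>. Re \<sigma> \<le> \<delta> \<Longrightarrow>
      norm (Gamma (1 - 5 * \<sigma>) * rGamma (1 - \<sigma>) ^ 5) * norm \<sigma> ^ 2 \<le> C * exp (- 5 * ln 5 * Re \<sigma>)"
    using Gamma_quintic_ratio_bound[OF \<delta>] by metis
  \<comment> \<open>With \<open>\<zeta> - 5 * ln 5 \<ge> 0\<close>, the surviving exponential is
    largest on the right edge \<open>Re \<sigma> = \<delta>\<close>.\<close>
  define M where "M = C * exp ((\<zeta> - 5 * ln 5) * \<delta>)"
  have M: "M \<ge> 0" using C by (simp add: M_def)
  have bound: "norm (quintic_kernel \<theta> \<sigma>) * norm \<sigma> ^ 2 * norm (cos (of_real pi * \<sigma>)) \<le>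
      M * exp \<bar>Im (of_real pi * \<sigma>)\<bar>" if \<sigma>: "Re \<sigma> \<le> \<delta>" for \<sigma>
  proof -
    have "norm (quintic_kernel \<theta> \<sigma>) * norm (cos (of_real pi * \<sigma>)) \<le>
        norm (Gamma (1 - 5 * \<sigma>) * rGamma (1 - \<sigma>) ^ 5) * norm (exp ((\<theta> - of_real pi * \<i>) * \<sigma>))"
      by (simp add: quintic_kernel_def norm_divide norm_mult)
    then have "norm (quintic_kernel \<theta> \<sigma>) * norm (cos (of_real pi * \<sigma>)) * norm \<sigma> ^ 2 \<le>
        norm (Gamma (1 - 5 * \<sigma>) * rGamma (1 - \<sigma>) ^ 5) * norm (exp ((\<theta> - of_real pi * \<i>) * \<sigma>)) * norm \<sigma> ^ 2"
      by (rule mult_right_mono) simp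
    also have "\<dots> = norm (Gamma (1 - 5 * \<sigma>) * rGamma (1 - \<sigma>) ^ 5) * norm \<sigma> ^ 2 *
        exp (\<zeta> * Re \<sigma> + pi * (1 - 2 * B) * Im \<sigma>)"
      by (simp add: \<theta> algebra_simps)
    also have "\<dots> \<le> (C * exp (- 5 * ln 5 * Re \<sigma>)) *
        exp (\<zeta> * Re \<sigma> + pi * (1 - 2 * B) * Im \<sigma>)"
      by (intro mult_right_mono C(2) \<sigma>) simp
    also have "\<dots> = C * (exp ((\<zeta> - 5 * ln 5) * Re \<sigma>) * exp (pi * (1 - 2 * B) * Im \<sigma>))"
      by (simp add: algebra_simps flip: exp_add)
    also have "\<dots> \<le> C * (exp ((\<zeta> - 5 * ln 5) * \<delta>) * exp \<bar>Im (of_real pi * \<sigma>)\<bar>)"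
    proof (intro mult_left_mono mult_mono C(1))
      show "exp ((\<zeta> - 5 * ln 5) * Re \<sigma>) \<le> exp ((\<zeta> - 5 * ln 5) * \<delta>)"
        using \<zeta> \<sigma> by (simp add: mult_left_mono)
      have "(1 - 2 * B) * Im \<sigma> \<le> \<bar>1 - 2 * B\<bar> * \<bar>Im \<sigma>\<bar>"
        by (simp flip: abs_mult)
      also have "\<dots> \<le> 1 * \<bar>Im \<sigma>\<bar>"
        using B by (intro mult_right_mono) auto
      finally show "exp (pi * (1 - 2 * B) * Im \<sigma>) \<le> exp \<bar>Im (of_real pi * \<sigma>)\<bar>"
        by (simp add: mult.assoc abs_mult)
    qed auto
    finally show ?thesis by (simp add: M_def mult_ac)
  qed
  show thesis
  \<comment> \<open>The factor 4 covers the constants 2 and 4 lost in the two lower bounds for the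
    cosine.\<close>
  proof (rule that[of "4 * M"])
    fix \<sigma> :: complex assume \<sigma>: "Re \<sigma> \<le> \<delta>"
    let ?k = "norm (quintic_kernel \<theta> \<sigma>) * norm \<sigma> ^ 2" and ?e = "exp \<bar>Im (of_real pi * \<sigma>)\<bar>"
    have "?k * (\<bar>cos (pi * Re \<sigma>)\<bar> * ?e / 2) \<le> ?k * norm (cos (of_real pi * \<sigma>))"
      using norm_cos_ge(1)[of "of_real pi * \<sigma>"] by (intro mult_left_mono) auto
    also note bound[OF \<sigma>]
    finally have "(?k * \<bar>cos (pi * Re \<sigma>)\<bar> / 2) * ?e \<le> M * ?e" by (simp add: mult_ac)
    then show "?k * \<bar>cos (pi * Re \<sigma>)\<bar> \<le> 4 * M"
      using M by simp
    assume "1 \<le> \<bar>Im \<sigma>\<bar>"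
    then have "1 * 1 \<le> pi * \<bar>Im \<sigma>\<bar>"
      using pi_ge_two by (intro mult_mono) auto
    then have "?e / 4 \<le> norm (cos (of_real pi * \<sigma>))"
      by (intro norm_cos_ge) (simp add: abs_mult)
    then have "?k * (?e / 4) \<le> ?k * norm (cos (of_real pi * \<sigma>))"
      by (intro mult_left_mono) auto
    also note bound[OF \<sigma>]
    finally have "(?k / 4) * ?e \<le> M * ?e" by (simp add: mult_ac)
    then show "?k \<le> 4 * M" by simp
  qed (use M in simp)
qed

section \<open>Poles and residues of the kernel\<close>

lemma cos_pi_times_eq_0_iff: "cos (of_real pi * \<sigma>) = 0 \<longleftrightarrow> (\<exists>n::int. \<sigma> = of_int n + 1 / 2)" for \<sigma> :: complex
proof -
  have "of_real pi * \<sigma> = of_int n * of_real pi + of_real pi / 2 \<longleftrightarrow> \<sigma> = of_int n + 1 / 2" for n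
  proof -
    have "of_int n * of_real pi + of_real pi / 2 = of_real pi * (of_int n + 1 / 2 :: complex)"
      by (simp add: algebra_simps)
    then show ?thesis by simp
  qed
  then show ?thesis by (simp add: cos_eq_0)
qed

lemma one_minus_5_not_nonpos: "Re \<sigma> < 1 / 5 \<Longrightarrow> 1 - 5 * \<sigma> \<notin> \<int>\<^sub>\<le>\<^sub>0"
  by (rule Re_pos_not_nonpos_Ints) simp

lemma quintic_kernel_holomorphic:
  assumes "\<And>\<sigma>. \<sigma> \<in> A \<Longrightarrow> Re \<sigma> < 1 / 5 \<and> cos (of_real pi * \<sigma>) \<noteq> 0"
  shows "quintic_kernel \<theta> holomorphic_on A"
  unfolding quintic_kernel_def using assms one_minus_5_not_nonpos
  by (intro holomorphic_intros holomorphic_Gamma' holomorphic_rGamma') auto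

text \<open>The pole is simple, so the residue is the numerator divided by the derivative
  \<open>pi * (-1) ^ k\<close> of the cosine. The exponential contributes
  \<open>exp (- \<theta> / 2) ^ d\<close> and the phase \<open>\<i> ^ d = \<i> * (-1) ^ k\<close>.
  The two signs cancel, which makes the prefactor the same for all \<open>d\<close>.\<close>

lemma residue_quintic_kernel:
  fixes k :: nat
  defines "d \<equiv> 2 * k + 1"
  shows "residue (quintic_kernel \<theta>) (- (of_nat d / 2)) =
    4 * \<i> / of_real pi ^ 3 * T_CY_term (exp (- \<theta> / 2)) d"
proof -
  let ?p = "- (of_nat d / 2) :: complex"
  define N where "N \<sigma> = Gamma (1 - 5 * \<sigma>) * rGamma (1 - \<sigma>) ^ 5 * exp ((\<theta> - of_real pi * \<i>) * \<sigma>)" for \<sigma>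
  have sin: "sin (of_real pi * (of_nat d / 2)) = (-1 :: complex) ^ k"
  proof -
    have "of_real pi * (of_nat d / 2) = (of_real (real k * pi + pi / 2) :: complex)"
      by (simp add: d_def field_simps)
    then have "sin (of_real pi * (of_nat d / 2)) = (of_real (sin (real k * pi + pi / 2)) :: complex)"
      by (simp only: sin_of_real)
    also have "sin (real k * pi + pi / 2) = (-1) ^ k"
      by (simp add: sin_add)
    finally show ?thesis by simp
  qed
  have N: "N ?p = 4 / of_real pi ^ 2 * T_CY_term (exp (- \<theta> / 2)) d * (\<i> * (-1) ^ k)"
  proof -
    have "exp ((\<theta> - of_real pi * \<i>) * ?p) =
        exp (of_nat d * (- \<theta> / 2)) * exp (of_nat d * (of_real pi / 2 * \<i>))"
      by (simp add: algebra_simps diff_divide_distrib flip: exp_add)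
    also have "\<dots> = exp (- \<theta> / 2) ^ d * exp (of_real pi / 2 * \<i>) ^ d"
      by (simp only: exp_of_nat_mult)
    also have "exp (of_real pi / 2 * \<i>) = \<i>"
      using cis_pi_half by (simp add: cis_conv_exp mult.commute)
    also have "\<i> ^ d = \<i> * (-1) ^ k"
      by (simp add: d_def power_mult)
    finally show ?thesis
      using Gamma_quintic_ratio_half_odd[of k]
      by (simp add: N_def T_CY_term_def d_def mult_ac)
  qed
  have nz: "T_CY_term (exp (- \<theta> / 2)) d \<noteq> 0"
  proof -
    have "double_fact n \<noteq> 0" for n
      by (induction n rule: double_fact.induct) auto
    then show ?thesis by (simp add: T_CY_term_def)
  qed
  have "residue (\<lambda>\<sigma>. N \<sigma> / cos (of_real pi * \<sigma>)) ?p = N ?p / (of_real pi * (-1) ^ k)"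
  proof (rule residue_simple_pole_deriv[where s = "{\<sigma>. Re \<sigma> < 1 / 5}"])
    show "N holomorphic_on {\<sigma>. Re \<sigma> < 1 / 5}"
      unfolding N_def using one_minus_5_not_nonpos
      by (intro holomorphic_intros holomorphic_Gamma' holomorphic_rGamma') auto
    show "(\<lambda>\<sigma>. cos (of_real pi * \<sigma>)) holomorphic_on {\<sigma>. Re \<sigma> < 1 / 5}"
      by (intro holomorphic_intros)
    show "((\<lambda>\<sigma>. cos (of_real pi * \<sigma>)) has_field_derivative of_real pi * (-1) ^ k) (at ?p)"
      using sin by (auto intro!: derivative_eq_intros)
    show "N ?p \<noteq> 0"
      unfolding N using nz by simp
    show "cos (of_real pi * ?p) = 0"
      unfolding cos_pi_times_eq_0_iff by (rule exI[of _ "- int k - 1"]) (simp add: d_def field_simps)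
    show "open {\<sigma>. Re \<sigma> < 1 / 5}" "connected {\<sigma>. Re \<sigma> < 1 / 5}"
      by (intro open_halfspace_Re_lt convex_connected convex_halfspace_Re_lt)+
  qed auto
  also have "(\<lambda>\<sigma>. N \<sigma> / cos (of_real pi * \<sigma>)) = quintic_kernel \<theta>"
    by (simp add: fun_eq_iff N_def quintic_kernel_def)
  finally show ?thesis
    unfolding N by (simp add: field_simps eval_nat_numeral)
qed

section \<open>Convergence of the line integrals and of the series\<close>

lemma integrable_inverse_1_plus_square_lborel: "integrable lborel (\<lambda>t::real. inverse (1 + t ^ 2))"
  using integrable_inverse_1_plus_square by (simp add: set_integrable_def)

text \<open>The estimate \<open>c ^ 2 + t ^ 2 \<ge> min 1 (c ^ 2) * (1 + t ^ 2)\<close> turns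
  quadratic decay into the integrable majorant \<open>inverse (1 + t ^ 2)\<close>. The minimum makes
  the constant uniform over lines with \<open>\<bar>c\<bar> \<ge> 1\<close> on which the cosine
  factor is fixed.\<close>

lemma quintic_kernel_line:
  assumes c: "c \<noteq> 0" "c < 1 / 5" "cos (pi * c) \<noteq> 0"
    and M: "\<And>t. norm (quintic_kernel \<theta> (Complex c t)) * norm (Complex c t) ^ 2 * \<bar>cos (pi * c)\<bar> \<le> M"
  shows "norm (quintic_kernel \<theta> (Complex c t)) \<le>
      M / (\<bar>cos (pi * c)\<bar> * min 1 (c ^ 2)) * inverse (1 + t ^ 2)"
    and "integrable lborel (\<lambda>t. quintic_kernel \<theta> (Complex c t))"
proof -
  have bound: "norm (quintic_kernel \<theta> (Complex c t)) \<le>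
      M / (\<bar>cos (pi * c)\<bar> * min 1 (c ^ 2)) * inverse (1 + t ^ 2)" for t
  proof -
    let ?k = "norm (quintic_kernel \<theta> (Complex c t))" and ?c = "\<bar>cos (pi * c)\<bar>"
    have "min 1 (c ^ 2) * (1 + t ^ 2) \<le> c ^ 2 + t ^ 2"
      using mult_right_mono[of "min 1 (c ^ 2)" 1 "t ^ 2"] by (simp add: distrib_left add_mono)
    then have "?k * (min 1 (c ^ 2) * (1 + t ^ 2)) * ?c \<le> ?k * (c ^ 2 + t ^ 2) * ?c"
      by (intro mult_right_mono mult_left_mono) auto
    also have "\<dots> \<le> M"
      using M[of t] by (simp add: cmod_power2)
    finally have "?k * (?c * min 1 (c ^ 2) * (1 + t ^ 2)) \<le> M"
      by (simp add: mult_ac)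
    moreover have "0 < ?c * min 1 (c ^ 2) * (1 + t ^ 2)"
      using c by (intro mult_pos_pos) (auto simp: add_pos_nonneg)
    ultimately have "?k \<le> M / (?c * min 1 (c ^ 2) * (1 + t ^ 2))"
      by (simp add: pos_le_divide_eq)
    then show ?thesis by (simp add: divide_inverse mult_ac)
  qed
  then show "norm (quintic_kernel \<theta> (Complex c t)) \<le>
      M / (\<bar>cos (pi * c)\<bar> * min 1 (c ^ 2)) * inverse (1 + t ^ 2)" .
  show "integrable lborel (\<lambda>t. quintic_kernel \<theta> (Complex c t))"
  proof (rule Bochner_Integration.integrable_bound)
    show "integrable lborel (\<lambda>t. M / (\<bar>cos (pi * c)\<bar> * min 1 (c ^ 2)) * inverse (1 + t ^ 2))"
      by (intro integrable_mult_right integrable_inverse_1_plus_square_lborel)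
    show "AE t in lborel. norm (quintic_kernel \<theta> (Complex c t)) \<le>
        norm (M / (\<bar>cos (pi * c)\<bar> * min 1 (c ^ 2)) * inverse (1 + t ^ 2))"
      using bound by (intro AE_I2) (metis abs_ge_self order_trans real_norm_def)
    \<comment> \<open>All zeros of the cosine are real, so the only possible one on this line is the
      point \<open>c\<close> itself.\<close>
    have "cos (of_real pi * \<sigma>) \<noteq> 0" if "Re \<sigma> = c" for \<sigma>
    proof
      assume "cos (of_real pi * \<sigma>) = 0"
      then obtain n :: int where "\<sigma> = of_int n + 1 / 2"
        by (auto simp: cos_pi_times_eq_0_iff)
      then have "\<sigma> = of_real c"
        using that by (auto simp: complex_eq_iff)
      with \<open>cos (of_real pi * \<sigma>) = 0\<close> have "cos (of_real (pi * c)) = (0 :: complex)"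
        by simp
      then have "of_real (cos (pi * c)) = (0 :: complex)"
        by (simp only: cos_of_real)
      with c show False by simp
    qed
    then have "quintic_kernel \<theta> holomorphic_on {\<sigma>. Re \<sigma> = c}"
      using c by (intro quintic_kernel_holomorphic) auto
    then have "continuous_on {\<sigma>. Re \<sigma> = c} (quintic_kernel \<theta>)"
      by (rule holomorphic_on_imp_continuous_on)
    moreover have "continuous_on UNIV (Complex c)"
      unfolding Complex_eq by (intro continuous_intros)
    ultimately have "continuous_on UNIV (\<lambda>t. quintic_kernel \<theta> (Complex c t))"
      by (rule continuous_on_compose2) auto
    then show "(\<lambda>t. quintic_kernel \<theta> (Complex c t)) \<in> borel_measurable lborel"
      by (simp add: borel_measurable_continuous_onI)
  qed
qed

text \<open>The coefficient of the term is, up to \<open>4 / pi ^ 2\<close>, the Gamma quotient at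
  \<open>\<sigma> = - d / 2\<close>. Its growth there is cancelled by the power of
  \<open>exp (- \<theta> / 2)\<close> as soon as \<open>Re \<theta> \<ge> 5 * ln 5\<close>, and the
  factor \<open>norm \<sigma> ^ 2\<close> leaves terms of order \<open>1 / d ^ 2\<close> even in the
  boundary case.\<close>

lemma T_CY_term_summable:
  assumes \<theta>: "5 * ln 5 \<le> Re \<theta>"
  shows "summable (\<lambda>k. norm (T_CY_term (exp (- \<theta> / 2)) (2 * k + 1)))"
proof -
  obtain C where C: "C \<ge> 0" "\<And>\<sigma>. Re \<sigma> \<le> 0 \<Longrightarrow>
      norm (Gamma (1 - 5 * \<sigma>) * rGamma (1 - \<sigma>) ^ 5) * norm \<sigma> ^ 2 \<le> C * exp (- 5 * ln 5 * Re \<sigma>)"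
    using Gamma_quintic_ratio_bound[of 0] by auto
  have bound: "norm (T_CY_term (exp (- \<theta> / 2)) (2 * k + 1)) \<le> C * pi ^ 2 * inverse (real (Suc k) ^ 2)" for k
  proof -
    define d where "d = 2 * k + 1"
    define A where "A = real (double_fact (5 * d)) / real (double_fact d) ^ 5"
    have A: "A \<ge> 0" by (simp add: A_def)
    have "Gamma (1 + 5 * of_nat d / 2) * rGamma (1 + of_nat d / 2 :: complex) ^ 5 = of_real (4 / pi ^ 2 * A)"
      using Gamma_quintic_ratio_half_odd[of k] by (simp add: A_def d_def)
    then have "(4 / pi ^ 2 * A) * (real d / 2) ^ 2 \<le> C * exp (5 * ln 5 * real d / 2)"
      using C(2)[of "- (of_nat d / 2)"] A by (simp add: norm_divide norm_power)
    then have "A * real d ^ 2 \<le> C * pi ^ 2 * exp (5 * ln 5 * real d / 2)"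
      by (simp add: power_divide field_simps)
    then have "A * real d ^ 2 * exp (- Re \<theta> / 2 * real d) \<le>
        C * pi ^ 2 * exp (5 * ln 5 * real d / 2) * exp (- Re \<theta> / 2 * real d)"
      by (rule mult_right_mono) simp
    also have "\<dots> = C * pi ^ 2 * exp ((5 * ln 5 - Re \<theta>) * (real d / 2))"
      by (simp add: algebra_simps diff_divide_distrib flip: exp_add)
    also have "\<dots> \<le> C * pi ^ 2 * 1"
      using \<theta> C(1) by (intro mult_left_mono) (auto intro!: mult_nonpos_nonneg)
    finally have "A * exp (- Re \<theta> / 2 * real d) * real d ^ 2 \<le> C * pi ^ 2"
      by (simp add: mult_ac)
    moreover have "A * exp (- Re \<theta> / 2 * real d) = norm (T_CY_term (exp (- \<theta> / 2)) d)"
      by (simp add: A_def T_CY_term_def norm_mult norm_divide norm_power mult.commute flip: exp_of_nat_mult)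
    ultimately have "norm (T_CY_term (exp (- \<theta> / 2)) d) * real d ^ 2 \<le> C * pi ^ 2"
      by simp
    moreover have "real (Suc k) ^ 2 \<le> real d ^ 2"
      by (intro power_mono) (auto simp: d_def)
    ultimately have "norm (T_CY_term (exp (- \<theta> / 2)) d) * real (Suc k) ^ 2 \<le> C * pi ^ 2"
      by (meson mult_left_mono norm_ge_zero order_trans)
    then show ?thesis
      by (simp add: d_def field_simps)
  qed
  show ?thesis
  proof (rule summable_comparison_test)
    have "summable (\<lambda>k. inverse (real k ^ 2))"
      by (rule inverse_power_summable) simp
    then have "summable (\<lambda>k. inverse (real (Suc k) ^ 2))"
      by (subst summable_Suc_iff)
    then show "summable (\<lambda>k. C * pi ^ 2 * inverse (real (Suc k) ^ 2))"
      by (rule summable_mult)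
    show "\<exists>N. \<forall>k\<ge>N. norm (norm (T_CY_term (exp (- \<theta> / 2)) (2 * k + 1))) \<le>
        C * pi ^ 2 * inverse (real (Suc k) ^ 2)"
      using bound by auto
  qed
qed

text \<open>The line is moved to \<open>Re \<sigma> = - (n + 1)\<close>, midway between two poles,
  where the cosine factor has absolute value 1. This crosses exactly the poles with
  \<open>k \<le> n\<close>, so a partial sum of residues is a difference of two line integrals, the
  second of which tends to zero.\<close>

lemma quintic_kernel_residues_sums:
  fixes \<zeta> B \<delta> :: real and \<theta> :: complex
  assumes \<theta>: "\<theta> = of_real \<zeta> + 2 * of_real pi * \<i> * of_real B"
    and \<zeta>: "5 * ln 5 \<le> \<zeta>" and B: "0 \<le> B" "B \<le> 1" and \<delta>: "0 < \<delta>" "\<delta> < 1 / 5"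
  shows "integrable lborel (\<lambda>t. quintic_kernel \<theta> (Complex \<delta> t))"
    and "(\<lambda>k. 2 * of_real pi * residue (quintic_kernel \<theta>) (- (of_nat (2 * k + 1) / 2))) sums
      (LINT t|lborel. quintic_kernel \<theta> (Complex \<delta> t))"
proof -
  let ?F = "quintic_kernel \<theta>"
  obtain M where M: "M \<ge> 0"
      "\<And>\<sigma>. Re \<sigma> \<le> \<delta> \<Longrightarrow> norm (?F \<sigma>) * norm \<sigma> ^ 2 * \<bar>cos (pi * Re \<sigma>)\<bar> \<le> M"
      "\<And>\<sigma>. Re \<sigma> \<le> \<delta> \<Longrightarrow> 1 \<le> \<bar>Im \<sigma>\<bar> \<Longrightarrow> norm (?F \<sigma>) * norm \<sigma> ^ 2 \<le> M"
    using quintic_kernel_bound[OF \<theta> \<zeta> B \<delta>(2)] by metis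
  have line: "norm (?F (Complex c t)) * norm (Complex c t) ^ 2 * \<bar>cos (pi * c)\<bar> \<le> M"
    if "c \<le> \<delta>" for c t
    using M(2)[of "Complex c t"] that by simp
  have "cos (pi * \<delta>) > 0"
    using \<delta> mult_strict_left_mono[of \<delta> "1 / 2" pi] by (intro cos_gt_zero) auto
  then show int_\<delta>: "integrable lborel (\<lambda>t. ?F (Complex \<delta> t))"
    using \<delta> line[of \<delta>] by (intro quintic_kernel_line(2)) auto
  have cos_int: "\<bar>cos (pi * (- real N))\<bar> = 1" for N
    by (simp add: mult.commute[of pi])
  have int_N: "integrable lborel (\<lambda>t. ?F (Complex (- real N) t))"
    and bound_N: "norm (?F (Complex (- real N) t)) \<le> M * inverse (1 + t ^ 2)" if "N > 0" for N t
  proof -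
    have cos_N: "cos (pi * (- real N)) \<noteq> 0"
      using cos_int[of N] by (metis abs_zero zero_neq_one)
    show "integrable lborel (\<lambda>t. ?F (Complex (- real N) t))"
      using that \<delta> cos_N by (intro quintic_kernel_line(2)[where M = M] line) auto
    have "min 1 ((- real N) ^ 2) = 1"
      using that by (simp add: min_def)
    then show "norm (?F (Complex (- real N) t)) \<le> M * inverse (1 + t ^ 2)"
      using quintic_kernel_line(1)[of "- real N" \<theta> M t] that \<delta> line[of "- real N"] cos_N cos_int[of N] by simp
  qed
  \<comment> \<open>The majorant \<open>M * inverse (1 + t ^ 2)\<close> is the same for all these
    lines, and pointwise the kernel is at most \<open>M\<close> divided by the square of the
    abscissa.\<close>
  have lim: "(\<lambda>n. LINT t|lborel. ?F (Complex (- real (Suc n)) t)) \<longlonglongrightarrow> (LINT t|(lborel :: real measure). (0 :: complex))"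
  proof (rule integral_dominated_convergence)
    show "AE t in lborel. (\<lambda>n. ?F (Complex (- real (Suc n)) t)) \<longlonglongrightarrow> 0"
    proof (rule AE_I2, rule Lim_null_comparison)
      fix t :: real
      show "\<forall>\<^sub>F n in sequentially. norm (?F (Complex (- real (Suc n)) t)) \<le> M * inverse (real (Suc n)) ^ 2"
      proof (rule always_eventually, rule allI)
        fix n
        let ?N = "real (Suc n)"
        have "norm (?F (Complex (- ?N) t)) * ?N ^ 2 \<le> norm (?F (Complex (- ?N) t)) * (?N ^ 2 + t ^ 2)"
          by (intro mult_left_mono) auto
        also have "\<dots> \<le> M"
          using line[of "- ?N" t] \<delta> cos_int[of "Suc n"] by (simp add: cmod_power2 del: of_nat_Suc)
        finally show "norm (?F (Complex (- ?N) t)) \<le> M * inverse ?N ^ 2"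
          by (simp add: field_simps del: of_nat_Suc)
      qed
      show "(\<lambda>n. M * inverse (real (Suc n)) ^ 2) \<longlonglongrightarrow> 0"
        using tendsto_mult[OF tendsto_const[of M] tendsto_power[OF LIMSEQ_inverse_real_of_nat, of 2]] by simp
    qed
    show "integrable lborel (\<lambda>t. M * inverse (1 + t ^ 2))"
      by (intro integrable_mult_right integrable_inverse_1_plus_square_lborel)
    show "AE t in lborel. norm (?F (Complex (- real (Suc n)) t)) \<le> M * inverse (1 + t ^ 2)" for n
      by (intro AE_I2 bound_N) simp
    show "(\<lambda>t. ?F (Complex (- real (Suc n)) t)) \<in> borel_measurable lborel" for n
      by (rule borel_measurable_integrable[OF int_N]) simp
  qed simp
  define p where "p k = (- (of_nat (2 * k + 1) / 2) :: complex)" for k :: nat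
  have shift: "(\<Sum>k<Suc n. 2 * of_real pi * residue ?F (p k)) =
      (LINT t|lborel. ?F (Complex \<delta> t)) - (LINT t|lborel. ?F (Complex (- real (Suc n)) t))" for n
  proof -
    have inj: "inj_on p {..<Suc n}"
      by (auto simp: inj_on_def p_def)
    have "(LINT t|lborel. ?F (Complex \<delta> t)) = (LINT t|lborel. ?F (Complex (- real (Suc n)) t)) +
        2 * of_real pi * (\<Sum>q\<in>p ` {..<Suc n}. residue ?F q)"
    \<comment> \<open>The open strip reaches to the next pole \<open>p (Suc n)\<close> on the left
      and to the first pole of \<open>Gamma (1 - 5 * \<sigma>)\<close> on the right, and contains
      neither.\<close>
    proof (rule integral_vertical_line_shift[where a' = "- real (Suc n) - 1 / 2" and b' = "1 / 5" and M = M])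
      show "- real (Suc n) < Re q \<and> Re q < \<delta>" if q: "q \<in> p ` {..<Suc n}" for q
      proof -
        obtain k where "q = p k" "k \<le> n"
          using q by (auto simp: less_Suc_eq_le)
        then have "Re q = - real k - 1 / 2" "real k \<le> real n"
          by (simp_all add: p_def add_divide_distrib)
        then show ?thesis
          using \<delta>(1) by simp
      qed
      show "?F holomorphic_on {z. - real (Suc n) - 1 / 2 < Re z \<and> Re z < 1 / 5} - p ` {..<Suc n}"
      proof (rule quintic_kernel_holomorphic, rule conjI)
        fix \<sigma> assume \<sigma>: "\<sigma> \<in> {z. - real (Suc n) - 1 / 2 < Re z \<and> Re z < 1 / 5} - p ` {..<Suc n}"
        then show "Re \<sigma> < 1 / 5" by simp
        show "cos (of_real pi * \<sigma>) \<noteq> 0"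
        proof
          assume "cos (of_real pi * \<sigma>) = 0"
          then obtain m :: int where m: "\<sigma> = of_int m + 1 / 2"
            by (auto simp: cos_pi_times_eq_0_iff)
          define k where "k = nat (- m - 1)"
          have "- real (Suc n) - 1 < real_of_int m" "real_of_int m < 0"
            using \<sigma> by (auto simp: m)
          then have "m < 0" "- m \<le> int (Suc n)" by linarith+
          then have k: "k < Suc n" "m = - int k - 1"
            by (auto simp: k_def)
          have "\<sigma> = p k"
            unfolding m k(2) p_def by (simp add: field_simps)
          with k(1) \<sigma> show False by blast
        qed
      qed
      show "norm (?F z) * \<bar>Im z\<bar> \<le> M" if "Re z \<le> \<delta>" "1 \<le> \<bar>Im z\<bar>" for z
      proof -
        have "\<bar>Im z\<bar> * 1 \<le> \<bar>Im z\<bar> * \<bar>Im z\<bar>"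
          using that by (intro mult_left_mono) auto
        also have "\<dots> \<le> norm z ^ 2"
          unfolding cmod_power2 by (simp add: power2_eq_square)
        finally have "norm (?F z) * \<bar>Im z\<bar> \<le> norm (?F z) * norm z ^ 2"
          by (intro mult_left_mono) auto
        also have "\<dots> \<le> M" using M(3) that by blast
        finally show ?thesis .
      qed
    qed (use \<delta> int_\<delta> int_N[of "Suc n"] in auto)
    then show ?thesis
      by (simp only: sum.reindex[OF inj] o_def sum_distrib_left[symmetric]) simp
  qed
  have "(\<lambda>n. \<Sum>k<Suc n. 2 * of_real pi * residue ?F (p k)) \<longlonglongrightarrow> (LINT t|lborel. ?F (Complex \<delta> t)) - 0"
    unfolding shift using lim by (intro tendsto_diff tendsto_const) simp
  then have "(\<lambda>n. \<Sum>k<n. 2 * of_real pi * residue ?F (p k)) \<longlonglongrightarrow> (LINT t|lborel. ?F (Complex \<delta> t))"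
    by (subst (asm) filterlim_sequentially_Suc) simp
  then show "(\<lambda>k. 2 * of_real pi * residue ?F (- (of_nat (2 * k + 1) / 2))) sums
      (LINT t|lborel. ?F (Complex \<delta> t))"
    unfolding sums_def p_def .
qed

text \<open>Convergence of the integral and of the series belongs to the conclusion because a
  divergent integral or unordered sum would be assigned the value 0, and an identity between such
  values would say nothing.\<close>

theorem proposition5p1:
  fixes \<zeta> B \<delta> :: real and \<theta> :: complex
  assumes "\<theta> = of_real \<zeta> + 2 * of_real pi * \<i> * of_real B"
    and "5 * ln 5 \<le> \<zeta>" and "0 \<le> B" and "B \<le> 1"
    and "admissible \<delta>"
  shows "integrable lborel (hemisphere_line brane \<delta> \<theta>) \<and>
         T_CY_term (exp (- \<theta> / 2)) summable_on {d. odd d} \<and>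
         Z_D2 brane \<delta> \<theta> = 64 * of_real pi ^ 3 * T_CY (exp (- \<theta> / 2))"
proof -
  let ?p = "of_real pi :: complex"
  define f where "f t = quintic_kernel \<theta> (Complex \<delta> t)" for t
  define L where "L = (LINT t|lborel. f t)"
  define T where "T = T_CY_term (exp (- \<theta> / 2))"
  note \<delta> = admissibleD[OF assms(5)]
  have int: "integrable lborel f"
    and sums: "(\<lambda>k. 2 * ?p * residue (quintic_kernel \<theta>) (- (of_nat (2 * k + 1) / 2))) sums L"
    using quintic_kernel_residues_sums[OF assms(1-4) \<delta>] by (simp_all add: f_def[abs_def] L_def)
  \<comment> \<open>The scaling factor is the reciprocal of
    \<open>2 * pi * (4 * \<i> / pi ^ 3)\<close>, the constant relating the residue series to that of
    \<open>T\<close>.\<close>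
  have "(\<lambda>k. ?p ^ 2 / (8 * \<i>) * (2 * ?p * residue (quintic_kernel \<theta>) (- (of_nat (2 * k + 1) / 2)))) sums
      (?p ^ 2 / (8 * \<i>) * L)"
    by (rule sums_mult[OF sums])
  moreover have "?p ^ 2 / (8 * \<i>) * (2 * ?p * residue (quintic_kernel \<theta>) (- (of_nat (2 * k + 1) / 2))) =
      T (2 * k + 1)" for k
    unfolding residue_quintic_kernel T_def by (simp add: eval_nat_numeral field_simps)
  ultimately have "(\<lambda>k. T (2 * k + 1)) sums (?p ^ 2 / (8 * \<i>) * L)"
    by simp
  \<comment> \<open>\<open>T_CY\<close> is an unordered sum, so the ordered series obtained from the
    residues has to converge absolutely.\<close>
  moreover have "summable (\<lambda>k. norm (T (2 * k + 1)))"
    unfolding T_def using assms(1,2) by (intro T_CY_term_summable) simp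
  ultimately have "((\<lambda>k. T (2 * k + 1)) has_sum (?p ^ 2 / (8 * \<i>) * L)) UNIV"
    by (intro norm_summable_imp_has_sum)
  then have "(T has_sum (?p ^ 2 / (8 * \<i>) * L)) (range (\<lambda>k. 2 * k + 1))"
    by (subst has_sum_reindex) (auto simp: inj_on_def o_def)
  moreover have "range (\<lambda>k::nat. 2 * k + 1) = {d. odd d}"
    by (auto elim!: oddE)
  ultimately have has_sum: "(T has_sum (?p ^ 2 / (8 * \<i>) * L)) {d. odd d}"
    by simp
  \<comment> \<open>The downward orientation reflects \<open>t\<close>, and its factor
    \<open>- \<i>\<close> cancels the \<i> in the constant of the integrand. The argument has the
    shape of an affine substitution, which is then used to remove the reflection.\<close>
  have "hemisphere_line brane \<delta> \<theta> t = 32 * ?p ^ 6 * f (0 + (- 1) * t)" for t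
  proof -
    have "Complex \<delta> (- t) = of_real \<delta> - \<i> * of_real t"
      by (simp add: complex_eq_iff)
    then show ?thesis
      using hemisphere_integrand_brane[of "Complex \<delta> (- t)" \<theta>] \<delta>
      by (simp add: hemisphere_line_def f_def)
  qed
  then have hl: "hemisphere_line brane \<delta> \<theta> = (\<lambda>t. 32 * ?p ^ 6 * f (0 + (- 1) * t))"
    by (rule ext)
  have refl: "integrable lborel (\<lambda>t. f (0 + (- 1) * t))"
    by (rule lborel_integrable_real_affine[OF int]) simp
  have "L = (LINT t|lborel. f (0 + (- 1) * t))"
    unfolding L_def by (subst lborel_integral_real_affine[where c = "- 1" and t = 0]) auto
  then have "Z_D2 brane \<delta> \<theta> = 1 / (2 * ?p * \<i>) * (32 * ?p ^ 6 * L)"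
    unfolding Z_D2_def hl by simp
  also have "\<dots> = 64 * ?p ^ 3 * (2 * (?p ^ 2 / (8 * \<i>) * L))"
    by (simp add: eval_nat_numeral field_simps)
  also have "\<dots> = 64 * ?p ^ 3 * T_CY (exp (- \<theta> / 2))"
    using infsumI[OF has_sum] by (simp add: T_CY_def T_def)
  finally show ?thesis
    using has_sum refl unfolding hl T_def summable_on_def by auto
qed

end
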